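(* Let $A,B\in\mathbb{R}^{n\times n}$ with $A$ Lyapunov regular and $B\in\{A\}_{\mathbb{R}}''$. Let $A=PJ_AP^{-1}$ be the real Jordan form of $A$ and let $\mathbb{H}_{A,B}\in\mathbb{R}^{w\times w}$ be the real Hill-Pick matrix defined in the context. Then $\mathbb{H}_{A,B}$ is of the block form $$\mathbb{H}_{A,B}=\begin{bmatrix}{}^1\mathbb{H}_{A,B}&{}^2\mathbb{H}_{A,B}\\ {}^2\mathbb{H}_{A,B}^T&{}^3\mathbb{H}_{A,B}\end{bmatrix},$$ where ${}^1\mathbb{H}_{A,B}=[{}^1\mathbb{H}_{A,B}^{(i,j)}]_{i,j=1}^{r_1}$, ${}^2\mathbb{H}_{A,B}=[{}^2\mathbb{H}_{A,B}^{(i,j)}]_{i=1,\dots,r_1}^{j=1,\dots,r_2}$, ${}^3\mathbb{H}_{A,B}=[{}^3\mathbb{H}_{A,B}^{(i,j)}]_{i,j=1}^{r_2}$ with ${}^1\mathbb{H}_{A,B}^{(i,j)}\in\mathbb{R}^{2m_{i,1}\times2m_{j,1}}$, ${}^2\mathbb{H}_{A,B}^{(i,j)}\in\mathbb{R}^{2m_{i,1}\times n_{j,1}}$, ${}^3\mathbb{H}_{A,B}^{(i,j)}\in\mathbb{R}^{n_{i,1}\times n_{j,1}}$ the submatrices determined by the index sets $\Upsilon_i^{(1)}$ and $\Upsilon_j^{(1)}$, $\Upsilon_i^{(1)}$ and $\Upsilon_j^{(2)}$, and $\Upsilon_i^{(2)}$ and $\Upsilon_j^{(2)}$, respectively. In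 particular, $B$ Lyapunov dominates $A$ if and only if the matrix $\mathbb{H}_{A,B}$ is positive semidefinite.
   Context: $A\in\mathbb{R}^{n\times n}$ with (complex) eigenvalues $\mu_1,\dots,\mu_n$ is Lyapunov regular if $\mu_i+\overline{\mu}_j\ne0$ for all $i,j$. $B$ Lyapunov dominates $A$ if for every real symmetric $H\in\mathbb{R}^{n\times n}$: $HA+A^TH\ge0$ implies $HB+B^TH\ge0$ (positive semidefinite). The bicommutant $\{A\}_{\mathbb{R}}''$ equals $\{p(A):p\in\mathbb{R}[x]\}$. Real Jordan form. For $\lambda=a+ib$ put $C_\lambda=\begin{bmatrix}a&b\\-b&a\end{bmatrix}$. Let $S_m=[\delta_{i+1,j}]_{i,j=1}^m$ be the upper shift, $J_m(C_\lambda)=I_m\otimes C_\lambda+S_m\otimes I_2\in\mathbb{R}^{2m\times 2m}$ and $J_m(\tau)=\tau I_m+S_m$ for $\tau\in\mathbb{R}$. Let $\lambda_1,\dots,\lambda_{r_1}$ be the distinct non-real eigenvalues of $A$, one from each complex conjugate pair, and $\tau_1,\dots,\tau_{r_2}$ the distinct real eigenvalues. Then $A=PJ_AP^{-1}$ with $P\in\mathbb{R}^{n\times n}$ invertible and $$J_A=\Big(\bigoplus_{s=1}^{r_1}\bigoplus_{p=1}^{l_s}J_{m_{s,p}}(C_{\lambda_s})\Big)\oplus\Big(\bigoplus_{j=1}^{r_2}\bigoplus_{q=1}^{k_j}J_{n_{j,q}}(\tau_j)\Big),$$ with $m_{s,1}\ge\dots\ge m_{s,l_s}$ and $n_{j,1}\ge\dots\ge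 n_{j,k_j}$. Put $\widetilde{B}=P^{-1}BP$, $m_s=\sum_{p}m_{s,p}$, $n_j=\sum_q n_{j,q}$. Real Hill-Pick matrix. Let $L_{J_A,\widetilde{B}}=\big(\widetilde{B}^T\otimes I_n+I_n\otimes\widetilde{B}^T\big)\big(J_A^T\otimes I_n+I_n\otimes J_A^T\big)^{-1}\in\mathbb{R}^{n^2\times n^2}$, viewed as an $n\times n$ block matrix with $n\times n$ blocks. Put $p_s=2m_1+\dots+2m_{s-1}$ for $1\le s\le r_1$ and $p'_j=2(m_1+\dots+m_{r_1})+n_1+\dots+n_{j-1}$ for $1\le j\le r_2$, and define the ordered lists of index pairs $$\Upsilon_s^{(1)}=\{(p_s+1,p_s+1),(p_s+2,p_s+1),\dots,(p_s+2m_{s,1},p_s+1)\},$$ $$\Upsilon_j^{(2)}=\{(p'_j+1,p'_j+1),(p'_j+2,p'_j+1),\dots,(p'_j+n_{j,1},p'_j+1)\}.$$ Let $\Upsilon$ be the concatenation $\Upsilon_1^{(1)},\dots,\Upsilon_{r_1}^{(1)},\Upsilon_1^{(2)},\dots,\Upsilon_{r_2}^{(2)}$, a list of $w=2m_{1,1}+\dots+2m_{r_1,1}+n_{1,1}+\dots+n_{r_2,1}$ pairs $(i_1,j_1),\dots,(i_w,j_w)$. The real Hill-Pick matrix $\mathbb{H}_{A,B}$ is the $w\times w$ matrix whose $(k,l)$ entry is the $(i_l,j_l)$ entry of the $(i_k,j_k)$ block of $L_{J_A,\widetilde{B}}$. *)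

theory Defs
  imports "Jordan_Normal_Form.Jordan_Normal_Form" "Jordan_Normal_Form.Gauss_Jordan_Elimination"
begin

(* All row and column indices are 0-based, as in the matrix library: the pair (i, j) of the
   mathematical text is the pair (i - 1, j - 1) here. *)

definition mat_inv :: "'a :: field mat \<Rightarrow> 'a mat" where
  "mat_inv M = the (mat_inverse M)"

definition symmetric_mat :: "'a mat \<Rightarrow> bool" where
  "symmetric_mat M \<longleftrightarrow> square_mat M \<and> transpose_mat M = M"

definition psd_mat :: "real mat \<Rightarrow> bool" where
  "psd_mat M \<longleftrightarrow> symmetric_mat M \<and> (\<forall>v \<in> carrier_vec (dim_row M). 0 \<le> v \<bullet> (M *\<^sub>v v))"

definition lyapunov_regular :: "real mat \<Rightarrow> bool" where
  "lyapunov_regular A \<longleftrightarrow>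
     (\<forall>\<mu> \<nu>. eigenvalue (map_mat complex_of_real A) \<mu> \<longrightarrow> eigenvalue (map_mat complex_of_real A) \<nu> \<longrightarrow>
        \<mu> + cnj \<nu> \<noteq> 0)"

definition lyapunov_dominates :: "real mat \<Rightarrow> real mat \<Rightarrow> bool" where
  "lyapunov_dominates B A \<longleftrightarrow>
     (\<forall>H \<in> carrier_mat (dim_row A) (dim_row A). symmetric_mat H \<longrightarrow>
        psd_mat (H * A + transpose_mat A * H) \<longrightarrow> psd_mat (H * B + transpose_mat B * H))"

definition commutant :: "nat \<Rightarrow> real mat set \<Rightarrow> real mat set" where
  "commutant n S = {C \<in> carrier_mat n n. \<forall>X \<in> S. C * X = X * C}"

definition bicommutant :: "real mat \<Rightarrow> real mat set" where
  "bicommutant A = commutant (dim_row A) (commutant (dim_row A) {A})"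

definition kron :: "'a :: times mat \<Rightarrow> 'a mat \<Rightarrow> 'a mat" (infixl "\<otimes>\<^sub>m" 70) where
  "A \<otimes>\<^sub>m B = mat (dim_row A * dim_row B) (dim_col A * dim_col B)
     (\<lambda>(i, j). A $$ (i div dim_row B, j div dim_col B) * B $$ (i mod dim_row B, j mod dim_col B))"

definition C_mat :: "complex \<Rightarrow> real mat" where
  "C_mat l = mat_of_rows_list 2 [[Re l, Im l], [- Im l, Re l]]"

(* jordan_block m 0 is the upper shift S_m, and jordan_block m t is J_m(t). *)
definition real_jordan_block :: "nat \<Rightarrow> complex \<Rightarrow> real mat" where
  "real_jordan_block m l = (1\<^sub>m m \<otimes>\<^sub>m C_mat l) + (jordan_block m 0 \<otimes>\<^sub>m 1\<^sub>m 2)"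

(* The Jordan structure is given by two lists: Cs lists the chosen non-real eigenvalues
   lambda_s, each with its block sizes [m_{s,1}, ..., m_{s,l_s}]; Rs lists the real eigenvalues
   tau_j, each with its block sizes [n_{j,1}, ..., n_{j,k_j}].  Hence r_1 = length Cs and
   r_2 = length Rs. *)

definition real_jordan_matrix :: "(complex \<times> nat list) list \<Rightarrow> (real \<times> nat list) list \<Rightarrow> real mat" where
  "real_jordan_matrix Cs Rs = diag_block_mat
     (concat (map (\<lambda>(l, ms). map (\<lambda>m. real_jordan_block m l) ms) Cs) @
      concat (map (\<lambda>(t, ns). map (\<lambda>k. jordan_block k t) ns) Rs))"

definition block_sizes :: "nat list \<Rightarrow> bool" where
  "block_sizes ms \<longleftrightarrow> ms \<noteq> [] \<and> (\<forall>m \<in> set ms. 0 < m) \<and> sorted_wrt (\<ge>) ms"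

(* A = P J_A P^{-1}.  The conditions on \<Lambda> say that Cs contains each non-real eigenvalue of A
   up to conjugation, exactly one from each conjugate pair. *)
definition real_jordan_form ::
  "real mat \<Rightarrow> real mat \<Rightarrow> (complex \<times> nat list) list \<Rightarrow> (real \<times> nat list) list \<Rightarrow> bool" where
  "real_jordan_form A P Cs Rs \<longleftrightarrow>
     (let n = dim_row A; \<Lambda> = set (map fst Cs) in
        A \<in> carrier_mat n n \<and> P \<in> carrier_mat n n \<and> invertible_mat P \<and>
        real_jordan_matrix Cs Rs \<in> carrier_mat n n \<and>
        A = P * real_jordan_matrix Cs Rs * mat_inv P \<and>
        distinct (map fst Cs) \<and> \<Lambda> \<inter> cnj ` \<Lambda> = {} \<and>
        \<Lambda> \<union> cnj ` \<Lambda> = {\<mu>. eigenvalue (map_mat complex_of_real A) \<mu> \<and> Im \<mu> \<noteq> 0} \<and>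
        distinct (map fst Rs) \<and> set (map fst Rs) = {\<tau>. eigenvalue A \<tau>} \<and>
        (\<forall>ms \<in> set (map snd Cs). block_sizes ms) \<and> (\<forall>ns \<in> set (map snd Rs). block_sizes ns))"

definition lyapunov_L :: "real mat \<Rightarrow> real mat \<Rightarrow> real mat" where
  "lyapunov_L J B = (let n = dim_row J; I = 1\<^sub>m n in
     (transpose_mat B \<otimes>\<^sub>m I + I \<otimes>\<^sub>m transpose_mat B) *
     mat_inv (transpose_mat J \<otimes>\<^sub>m I + I \<otimes>\<^sub>m transpose_mat J))"

definition complex_offset :: "(complex \<times> nat list) list \<Rightarrow> nat \<Rightarrow> nat" where
  "complex_offset Cs s = (\<Sum>t<s. 2 * sum_list (snd (Cs ! t)))"

definition real_offset :: "(complex \<times> nat list) list \<Rightarrow> (real \<times> nat list) list \<Rightarrow> nat \<Rightarrow> nat" where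
  "real_offset Cs Rs j = complex_offset Cs (length Cs) + (\<Sum>t<j. sum_list (snd (Rs ! t)))"

definition complex_sizes :: "(complex \<times> nat list) list \<Rightarrow> nat list" where
  "complex_sizes Cs = map (\<lambda>(l, ms). 2 * hd ms) Cs"

definition real_sizes :: "(real \<times> nat list) list \<Rightarrow> nat list" where
  "real_sizes Rs = map (\<lambda>(t, ns). hd ns) Rs"

definition Upsilon1 :: "(complex \<times> nat list) list \<Rightarrow> nat \<Rightarrow> (nat \<times> nat) list" where
  "Upsilon1 Cs s =
     map (\<lambda>k. (complex_offset Cs s + k, complex_offset Cs s)) [0..<2 * hd (snd (Cs ! s))]"

definition Upsilon2 ::
  "(complex \<times> nat list) list \<Rightarrow> (real \<times> nat list) list \<Rightarrow> nat \<Rightarrow> (nat \<times> nat) list" where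
  "Upsilon2 Cs Rs j =
     map (\<lambda>k. (real_offset Cs Rs j + k, real_offset Cs Rs j)) [0..<hd (snd (Rs ! j))]"

definition Upsilon ::
  "(complex \<times> nat list) list \<Rightarrow> (real \<times> nat list) list \<Rightarrow> (nat \<times> nat) list" where
  "Upsilon Cs Rs =
     concat (map (Upsilon1 Cs) [0..<length Cs]) @ concat (map (Upsilon2 Cs Rs) [0..<length Rs])"

definition nth_block :: "nat \<Rightarrow> 'a mat \<Rightarrow> nat \<times> nat \<Rightarrow> 'a mat" where
  "nth_block n L = (\<lambda>(i, j). mat n n (\<lambda>(a, b). L $$ (i * n + a, j * n + b)))"

(* The (k, l) entry is the vs_l entry of the us_k block of L; for us = vs = Upsilon this is the
   real Hill-Pick matrix, for other lists of index pairs the submatrix they determine. *)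
definition hill_pick_sub :: "nat \<Rightarrow> real mat \<Rightarrow> (nat \<times> nat) list \<Rightarrow> (nat \<times> nat) list \<Rightarrow> real mat" where
  "hill_pick_sub n L us vs =
     mat (length us) (length vs) (\<lambda>(k, l). nth_block n L (us ! k) $$ (vs ! l))"

definition hill_pick_L ::
  "real mat \<Rightarrow> real mat \<Rightarrow> (complex \<times> nat list) list \<Rightarrow> (real \<times> nat list) list \<Rightarrow> real mat" where
  "hill_pick_L B P Cs Rs = lyapunov_L (real_jordan_matrix Cs Rs) (mat_inv P * B * P)"

definition real_hill_pick ::
  "real mat \<Rightarrow> real mat \<Rightarrow> (complex \<times> nat list) list \<Rightarrow> (real \<times> nat list) list \<Rightarrow> real mat" where
  "real_hill_pick B P Cs Rs =
     hill_pick_sub (dim_row B) (hill_pick_L B P Cs Rs) (Upsilon Cs Rs) (Upsilon Cs Rs)"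

(* locate rs i = (a, k): position i of a range partitioned into consecutive pieces of lengths rs
   is position k of the a-th piece. *)
fun locate :: "nat list \<Rightarrow> nat \<Rightarrow> nat \<times> nat" where
  "locate [] i = (0, i)"
| "locate (r # rs) i = (if i < r then (0, i) else (case locate rs (i - r) of (a, k) \<Rightarrow> (Suc a, k)))"

(* The block matrix [X i j] with row sizes rs and column sizes cs. *)
definition block_mat :: "nat list \<Rightarrow> nat list \<Rightarrow> (nat \<Rightarrow> nat \<Rightarrow> 'a mat) \<Rightarrow> 'a mat" where
  "block_mat rs cs X = mat (sum_list rs) (sum_list cs)
     (\<lambda>(i, j). case (locate rs i, locate cs j) of ((a, k), (b, l)) \<Rightarrow> X a b $$ (k, l))"

end

theory Submission
  imports Defs "Jordan_Normal_Form.Schur_Decomposition"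
begin

text \<open>Lyapunov regularity makes \<open>H \<mapsto> H J + J\<^sup>T H\<close> invertible, so there is a linear map \<open>\<Phi>\<close> with
  \<open>\<Phi> (H J + J\<^sup>T H) = H C + C\<^sup>T H\<close>, where \<open>J\<close> is the Jordan form of \<open>A\<close>, \<open>Q\<close> is the
  inverse of \<open>P\<close>, and \<open>C = Q B P\<close>; the matrix of \<open>\<Phi>\<close> in column-major coordinates is \<open>L\<close>, and \<open>B\<close> dominates \<open>A\<close> iff \<open>\<Phi>\<close> is positive. Since \<open>C\<close> lies in the
  bicommutant of \<open>J\<close>, we have \<open>\<Phi> (X\<^sup>T K Y) = X\<^sup>T \<Phi> K Y\<close> for all \<open>X\<close>, \<open>Y\<close> commuting with \<open>J\<close>.

  Let \<open>u\<close> be the sum of the first basis vectors of the largest blocks, one for each eigenvalue. Every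
  vector is \<open>X\<^sup>T u\<close> for some \<open>X\<close> in the commutant of \<open>J\<close>, so \<open>\<Phi> (v v\<^sup>T) = X\<^sup>T \<Phi> (u u\<^sup>T) X\<close>, and \<open>\<Phi>\<close> is
  positive iff \<open>\<Phi> (u u\<^sup>T)\<close> is positive semidefinite. Compressing with the projections onto the largest
  blocks, which also commute with \<open>J\<close>, shows that the Hill-Pick matrix is the restriction of \<open>\<Phi> (u u\<^sup>T)\<close>
  to the indices of those blocks, and that \<open>\<Phi> (u u\<^sup>T)\<close> vanishes elsewhere.\<close>

subsection \<open>Sylvester operators\<close>

text \<open>The transpose stays unconjugated over the complex numbers too, so that complexifying
  real matrices commutes with the operator.\<close>

definition lyapunov_op :: "'a::comm_ring_1 mat \<Rightarrow> 'a mat \<Rightarrow> 'a mat" where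
  "lyapunov_op A H = H * A + transpose_mat A * H"

lemma lyapunov_op_carrier [simp]:
  "A \<in> carrier_mat n n \<Longrightarrow> H \<in> carrier_mat n n \<Longrightarrow> lyapunov_op A H \<in> carrier_mat n n"
  by (auto simp: lyapunov_op_def)

text \<open>\<open>A\<close> moves past \<open>Y\<close> and, by the transposed relation, past
  \<open>X^T\<close>, and reappears on the outside as \<open>J\<close>. For \<open>X = Y\<close>
  invertible this is a change of basis; for \<open>A = J\<close> and \<open>X\<close>,
  \<open>Y\<close> in the commutant it will make \<Phi> a bimodule map.\<close>

lemma lyapunov_op_intertwine:
  assumes c: "A \<in> carrier_mat n n" "J \<in> carrier_mat n n" "X \<in> carrier_mat n n" "Y \<in> carrier_mat n n"
    "H \<in> carrier_mat n n"
    and X: "A * X = X * J" and Y: "A * Y = Y * J"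
  shows "transpose_mat X * lyapunov_op A H * Y = lyapunov_op J (transpose_mat X * H * Y)"
proof -
  note a = assoc_mult_mat[where n\<^sub>1=n and n\<^sub>2=n and n\<^sub>3=n and n\<^sub>4=n]
  have Xt: "transpose_mat X * transpose_mat A = transpose_mat J * transpose_mat X"
    using arg_cong[OF X, of transpose_mat] c by (simp add: transpose_mult)
  have "transpose_mat X * lyapunov_op A H * Y = transpose_mat X * (H * (A * Y)) + (transpose_mat X * transpose_mat A) * (H * Y)"
    using c by (simp add: lyapunov_op_def a mult_add_distrib_mat[where nr=n and n=n and nc=n]
        add_mult_distrib_mat[where nr=n and n=n and nc=n])
  also have "\<dots> = lyapunov_op J (transpose_mat X * H * Y)"
    unfolding X Y Xt using c by (simp add: lyapunov_op_def a)
  finally show ?thesis .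
qed

lemma lyapunov_op_add:
  assumes "A \<in> carrier_mat n n" "H \<in> carrier_mat n n" "K \<in> carrier_mat n n"
  shows "lyapunov_op A (H + K) = lyapunov_op A H + lyapunov_op A K"
proof -
  have e: "(H + K) * A = H * A + K * A"
    "transpose_mat A * (H + K) = transpose_mat A * H + transpose_mat A * K"
    using assms by (auto intro: add_mult_distrib_mat mult_add_distrib_mat)
  show ?thesis unfolding lyapunov_op_def e using assms
    by (intro eq_matI) (auto simp del: index_mult_mat(1))
qed

lemma lyapunov_op_transpose:
  assumes "A \<in> carrier_mat n n" "H \<in> carrier_mat n n"
  shows "lyapunov_op A (transpose_mat H) = transpose_mat (lyapunov_op A H)"
  using assms by (simp add: lyapunov_op_def transpose_add[of _ n n] transpose_mult[of _ n n]
      comm_add_mat[of "transpose_mat H * A" n n])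

section \<open>Triple products and matrix inverses\<close>

lemma mult_mat3_vec:
  assumes "X \<in> carrier_mat n m" "F \<in> carrier_mat m k" "Y \<in> carrier_mat k l" "v \<in> carrier_vec l"
  shows "(X * F * Y) *\<^sub>v v = X *\<^sub>v (F *\<^sub>v (Y *\<^sub>v v))"
  using assms assoc_mult_mat_vec[of "X * F" n k Y l v] assoc_mult_mat_vec[of X n m F k "Y *\<^sub>v v"]
  by (simp del: assoc_mult_mat assoc_mult_mat_vec)

lemma transpose_mult3:
  fixes X :: "'a :: comm_semiring_0 mat"
  assumes "X \<in> carrier_mat n m" "F \<in> carrier_mat m k" "Y \<in> carrier_mat k l"
  shows "transpose_mat (X * F * Y) = transpose_mat Y * transpose_mat F * transpose_mat X"
proof -
  have "transpose_mat (X * F * Y) = transpose_mat Y * transpose_mat (X * F)"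
    using assms by (intro transpose_mult) auto
  also have "transpose_mat (X * F) = transpose_mat F * transpose_mat X"
    using assms by (intro transpose_mult)
  finally show ?thesis using assms
    assoc_mult_mat[of "transpose_mat Y" l k "transpose_mat F" m "transpose_mat X" n] by simp
qed

lemma mat_inv_eq:
  assumes M: "M \<in> carrier_mat n n" and d: "det M \<noteq> 0"
  shows "mat_inv M \<in> carrier_mat n n" "M * mat_inv M = 1\<^sub>m n" "mat_inv M * M = 1\<^sub>m n"
proof -
  from det_non_zero_imp_unit[OF M d, of "()"] mat_inverse(1)[OF M, of "()"]
  obtain N where "mat_inverse M = Some N" by (cases "mat_inverse M") auto
  with mat_inverse(2)[OF M this]
  show "mat_inv M \<in> carrier_mat n n" "M * mat_inv M = 1\<^sub>m n" "mat_inv M * M = 1\<^sub>m n"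
    by (auto simp: mat_inv_def)
qed

lemma invertible_mat_det:
  fixes M :: "'a :: field mat"
  assumes M: "M \<in> carrier_mat n n" and i: "invertible_mat M"
  shows "det M \<noteq> 0"
proof -
  from i obtain B where B: "M * B = 1\<^sub>m n" "B * M = 1\<^sub>m (dim_row B)"
    using M by (auto simp: invertible_mat_def inverts_mat_def)
  \<comment> \<open>\<open>inverts_mat\<close> does not fix the shape of \<open>B\<close>; the
    dimensions of the two products do.\<close>
  have "B \<in> carrier_mat n n"
    using arg_cong[OF B(1), of dim_col] arg_cong[OF B(2), of dim_col] M by auto
  from det_mult[OF M this] B(1) show ?thesis by auto
qed

text \<open>As \<open>T\<close> is upper triangular, entry \<open>(i, j)\<close> of the equation
  involves \<open>G\<close> only further left in row \<open>i\<close>, further up in column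
  \<open>j\<close>, and at \<open>(i, j)\<close> itself with coefficient
  \<open>T $$ (i, i) + T $$ (j, j)\<close>. Induction on \<open>i + j\<close> kills the entries one
  by one.\<close>

lemma lyapunov_op_triangular_inj:
  fixes T :: "'a :: field mat"
  assumes c: "T \<in> carrier_mat n n" "G \<in> carrier_mat n n" and ut: "upper_triangular T"
    and d: "\<And>i j. i < n \<Longrightarrow> j < n \<Longrightarrow> T $$ (i, i) + T $$ (j, j) \<noteq> 0"
    and z: "lyapunov_op T G = 0\<^sub>m n n"
  shows "G = 0\<^sub>m n n"
proof -
  have "i < n \<longrightarrow> j < n \<longrightarrow> G $$ (i, j) = 0" for i j
  proof (induction "i + j" arbitrary: i j rule: less_induct)
    case less
    show ?case
    proof (intro impI)
      assume ij: "i < n" "j < n"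
      have "0 = (\<Sum>k = 0..<n. G $$ (i, k) * T $$ (k, j)) + (\<Sum>k = 0..<n. T $$ (k, i) * G $$ (k, j))"
        using arg_cong[OF z, of "\<lambda>M. M $$ (i, j)"] ij c
        by (simp add: lyapunov_op_def scalar_prod_def)
      also have "(\<Sum>k = 0..<n. G $$ (i, k) * T $$ (k, j)) = (\<Sum>k = 0..<n. if k = j then G $$ (i, j) * T $$ (j, j) else 0)"
      proof (rule sum.cong[OF refl])
        fix k assume "k \<in> {0..<n}"
        then show "G $$ (i, k) * T $$ (k, j) = (if k = j then G $$ (i, j) * T $$ (j, j) else 0)"
          using less[of i k] ut c(1) ij by (cases k j rule: linorder_cases) (auto simp: upper_triangular_def)
      qed
      also have "(\<Sum>k = 0..<n. T $$ (k, i) * G $$ (k, j)) = (\<Sum>k = 0..<n. if k = i then T $$ (i, i) * G $$ (i, j) else 0)"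
      proof (rule sum.cong[OF refl])
        fix k assume "k \<in> {0..<n}"
        then show "T $$ (k, i) * G $$ (k, j) = (if k = i then T $$ (i, i) * G $$ (i, j) else 0)"
          using less[of k j] ut c(1) ij by (cases k i rule: linorder_cases) (auto simp: upper_triangular_def)
      qed
      finally have "G $$ (i, j) * (T $$ (i, i) + T $$ (j, j)) = 0"
        using ij by (simp add: algebra_simps)
      with d[OF ij] show "G $$ (i, j) = 0" by simp
    qed
  qed
  then show ?thesis using c by (intro eq_matI) auto
qed

text \<open>Congruence by \<open>P\<close> carries kernel to kernel and \<open>Q\<close> undoes it.
  It is used over the complex numbers to pass from a Schur form to \<open>A\<close>, and over the
  reals to pass from \<open>A\<close> to its Jordan form.\<close>

lemma lyapunov_op_inj_of_inverse:
  assumes c: "A \<in> carrier_mat n n" "J \<in> carrier_mat n n" "P \<in> carrier_mat n n" "Q \<in> carrier_mat n n"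
    and PQ: "P * Q = 1\<^sub>m n" and AP: "A * P = P * J"
    and inj: "\<And>G. G \<in> carrier_mat n n \<Longrightarrow> lyapunov_op J G = 0\<^sub>m n n \<Longrightarrow> G = 0\<^sub>m n n"
    and H: "H \<in> carrier_mat n n" and z: "lyapunov_op A H = 0\<^sub>m n n"
  shows "H = 0\<^sub>m n n"
proof -
  note a = assoc_mult_mat[where n\<^sub>1=n and n\<^sub>2=n and n\<^sub>3=n and n\<^sub>4=n]
  have "lyapunov_op J (transpose_mat P * H * P) = 0\<^sub>m n n"
    using lyapunov_op_intertwine[OF c(1,2,3,3) H AP AP] c by (simp add: z)
  then have 0: "transpose_mat P * H * P = 0\<^sub>m n n" using inj[of "transpose_mat P * H * P"] c H by auto
  have t: "transpose_mat Q * transpose_mat P = 1\<^sub>m n"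
    using arg_cong[OF PQ, of transpose_mat] c by (simp add: transpose_mult)
  have "H = (transpose_mat Q * transpose_mat P) * (H * (P * Q))"
    unfolding t PQ using H by simp
  also have "\<dots> = transpose_mat Q * (transpose_mat P * H * P) * Q"
    using c H by (simp add: a)
  finally show ?thesis unfolding 0 using c by simp
qed

text \<open>A Schur form of the complexified matrix is upper triangular with eigenvalues of
  \<open>A\<close> on its diagonal, so the triangular case applies.\<close>

lemma lyapunov_op_inj:
  assumes A: "A \<in> carrier_mat n n" and reg: "lyapunov_regular A"
    and H: "H \<in> carrier_mat n n" and z: "lyapunov_op A H = 0\<^sub>m n n"
  shows "H = 0\<^sub>m n n"
proof -
  let ?c = complex_of_real
  let ?A = "map_mat ?c A" and ?H = "map_mat ?c H"
  have cA: "?A \<in> carrier_mat n n" using A by simp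
  obtain es where "char_poly ?A = (\<Prod>a \<leftarrow> es. [:- a, 1:])"
    using char_poly_factorized[OF cA] by auto
  from schur_decomposition_exists[OF cA this] obtain T where T: "T \<in> carrier_mat n n"
    "upper_triangular T" "similar_mat ?A T" by auto
  from T(3) obtain P Q where w: "similar_mat_wit ?A T P Q" unfolding similar_mat_def by auto
  note w = similar_mat_witD2[OF cA w]
  have AP: "?A * P = P * T"
    using w by (simp add: assoc_mult_mat[of _ n n _ n _ n])
  have ev: "eigenvalue ?A (T $$ (i, i))" if "i < n" for i
    unfolding eigenvalue_root_char_poly[OF cA] char_poly_similar[OF T(3)]
      char_poly_upper_triangular[OF T(1,2)]
    using that T(1) by (auto simp: poly_prod_list prod_list_zero_iff diag_mat_def image_iff)
  \<comment> \<open>Regularity excludes zero sums of an eigenvalue and a conjugated eigenvalue,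
    while the unconjugated transpose produces \<open>T $$ (i, i) + T $$ (j, j)\<close>. The spectrum
    of a real matrix is closed under conjugation, which bridges the two.\<close>
  have cnj: "eigenvalue ?A (cnj m)" if "eigenvalue ?A m" for m
  proof -
    have "char_poly ?A = map_poly ?c (char_poly A)" using of_real_hom.char_poly_hom[OF A] by simp
    then show ?thesis using that unfolding eigenvalue_root_char_poly[OF cA]
      using poly_cnj_real[of "map_poly ?c (char_poly A)" m] by (simp add: coeff_map_poly)
  qed
  have "?H = 0\<^sub>m n n"
  proof (rule lyapunov_op_inj_of_inverse[OF cA T(1) w(6,7) w(1) AP])
    fix G :: "complex mat" assume G: "G \<in> carrier_mat n n" "lyapunov_op T G = 0\<^sub>m n n"
    have "T $$ (i, i) + T $$ (j, j) \<noteq> 0" if "i < n" "j < n" for i j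
      using reg[unfolded lyapunov_regular_def, rule_format, OF ev[OF that(1)] cnj[OF ev[OF that(2)]]] by simp
    from lyapunov_op_triangular_inj[OF T(1) G(1) T(2) this G(2)] show "G = 0\<^sub>m n n" .
  next
    show "?H \<in> carrier_mat n n" using H by simp
    have "lyapunov_op ?A ?H = map_mat ?c (lyapunov_op A H)"
      unfolding lyapunov_op_def using A H
      by (intro eq_matI) (auto simp: scalar_prod_def)
    then show "lyapunov_op ?A ?H = 0\<^sub>m n n" unfolding z by auto
  qed
  then have "?c (H $$ (i, j)) = 0" if "i < n" "j < n" for i j
    using that H by (metis carrier_matD index_map_mat(1) index_zero_mat(1))
  then show ?thesis using H by (intro eq_matI) auto
qed

subsection \<open>Positive semidefinite matrices\<close>

lemma psd_mat_iff:
  assumes "K \<in> carrier_mat n n"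
  shows "psd_mat K \<longleftrightarrow> transpose_mat K = K \<and> (\<forall>v \<in> carrier_vec n. 0 \<le> v \<bullet> (K *\<^sub>v v))"
  using assms by (auto simp: psd_mat_def symmetric_mat_def)

definition outer :: "'a::comm_ring_1 vec \<Rightarrow> 'a vec \<Rightarrow> 'a mat" where
  "outer u v = mat (dim_vec u) (dim_vec v) (\<lambda>(i, j). u $ i * v $ j)"

lemma outer_carrier [simp]:
  "u \<in> carrier_vec n \<Longrightarrow> v \<in> carrier_vec m \<Longrightarrow> outer u v \<in> carrier_mat n m"
  by (auto simp: outer_def)

lemma index_outer [simp]:
  "i < dim_vec u \<Longrightarrow> j < dim_vec v \<Longrightarrow> outer u v $$ (i, j) = u $ i * v $ j"
  by (simp add: outer_def)

lemma mult_outer_mult: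
  assumes "X \<in> carrier_mat n n" "Y \<in> carrier_mat n n" "u \<in> carrier_vec n" "v \<in> carrier_vec n"
  shows "transpose_mat X * outer u v * Y = outer (transpose_mat X *\<^sub>v u) (transpose_mat Y *\<^sub>v v)"
proof (rule eq_matI)
  fix i j assume "i < dim_row (outer (transpose_mat X *\<^sub>v u) (transpose_mat Y *\<^sub>v v))"
    "j < dim_col (outer (transpose_mat X *\<^sub>v u) (transpose_mat Y *\<^sub>v v))"
  then have ij: "i < n" "j < n" using assms by (auto simp: outer_def)
  have "(transpose_mat X * outer u v) $$ (i, k) = (transpose_mat X *\<^sub>v u) $ i * v $ k" if "k < n" for k
    using assms ij that
    by (auto simp: scalar_prod_def sum_distrib_right sum_distrib_left outer_def mult.assoc intro!: sum.cong)
  then have "(transpose_mat X * outer u v * Y) $$ (i, j) =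
      (\<Sum>k = 0..<n. (transpose_mat X *\<^sub>v u) $ i * v $ k * Y $$ (k, j))"
    using assms ij
    by (subst index_mult_mat) (auto simp: scalar_prod_def outer_def intro!: sum.cong simp del: index_mult_mat_vec)
  also have "\<dots> = (transpose_mat X *\<^sub>v u) $ i * (\<Sum>k = 0..<n. v $ k * Y $$ (k, j))"
    by (simp add: sum_distrib_left mult.assoc)
  also have "(\<Sum>k = 0..<n. v $ k * Y $$ (k, j)) = (transpose_mat Y *\<^sub>v v) $ j"
    using assms ij by (auto simp: scalar_prod_def mult.commute intro!: sum.cong)
  finally show "(transpose_mat X * outer u v * Y) $$ (i, j) =
      outer (transpose_mat X *\<^sub>v u) (transpose_mat Y *\<^sub>v v) $$ (i, j)"
    using assms ij by (simp del: index_mult_mat_vec)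
qed (use assms in \<open>auto simp: outer_def\<close>)

lemma psd_mat_congruence:
  assumes "K \<in> carrier_mat n n" "Z \<in> carrier_mat n m" "psd_mat K"
  shows "psd_mat (transpose_mat Z * K * Z)"
proof -
  have c: "transpose_mat Z * K * Z \<in> carrier_mat m m" using assms by auto
  have "transpose_mat (transpose_mat Z * K * Z) = transpose_mat Z * transpose_mat K * Z"
    using transpose_mult3[of "transpose_mat Z" m n K n Z m] assms by simp
  then have "transpose_mat (transpose_mat Z * K * Z) = transpose_mat Z * K * Z"
    using assms by (simp add: psd_mat_iff)
  moreover have "0 \<le> v \<bullet> ((transpose_mat Z * K * Z) *\<^sub>v v)" if v: "v \<in> carrier_vec m" for v
  proof -
    have "v \<bullet> ((transpose_mat Z * K * Z) *\<^sub>v v) = v \<bullet> (transpose_mat Z *\<^sub>v (K *\<^sub>v (Z *\<^sub>v v)))"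
      using assms v by (subst mult_mat3_vec[of _ m n _ n _ m]) auto
    also have "\<dots> = (Z *\<^sub>v v) \<bullet> (K *\<^sub>v (Z *\<^sub>v v))"
      using transpose_vec_mult_scalar[of "transpose_mat Z" m n "K *\<^sub>v (Z *\<^sub>v v)" v] assms v by simp
    also have "0 \<le> \<dots>" using assms v by (auto simp: psd_mat_iff)
    finally show ?thesis .
  qed
  ultimately show ?thesis using psd_mat_iff[OF c] by blast
qed

lemma psd_mat_add:
  assumes "K \<in> carrier_mat n n" "L \<in> carrier_mat n n" "psd_mat K" "psd_mat L"
  shows "psd_mat (K + L)"
  using assms by (subst psd_mat_iff[of _ n])
    (auto simp: psd_mat_iff transpose_add add_mult_distrib_mat_vec[of _ n n] scalar_prod_add_distrib[of _ n])

lemma outer_mult_vec: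
  assumes "u \<in> carrier_vec n" "v \<in> carrier_vec n" "x \<in> carrier_vec n"
  shows "outer u v *\<^sub>v x = (v \<bullet> x) \<cdot>\<^sub>v u"
  using assms by (intro eq_vecI) (auto simp: outer_def scalar_prod_def sum_distrib_left sum_distrib_right ac_simps)

lemma transpose_outer: "transpose_mat (outer u v) = outer v u"
  by (intro eq_matI) (auto simp: outer_def)

lemma psd_outer:
  assumes "u \<in> carrier_vec n"
  shows "psd_mat (outer u u)"
  using assms comm_scalar_prod[OF assms]
  by (subst psd_mat_iff[of _ n]) (auto simp: outer_mult_vec transpose_outer)

section \<open>Positive semidefinite matrices as sums of rank-one matrices\<close>

lemma quadratic_nonneg_discriminant:
  fixes a b c :: real
  assumes "0 \<le> c" and "\<And>t. 0 \<le> a + 2 * b * t + c * t\<^sup>2"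
  shows "b\<^sup>2 \<le> a * c"
proof (cases "c = 0")
  case True
  have "b = 0"
  proof (rule ccontr)
    assume "b \<noteq> 0"
    \<comment> \<open>At this \<open>t\<close> the polynomial, which is linear since
      \<open>c = 0\<close>, takes the value -1.\<close>
    with assms(2)[of "- (a + 1) / (2 * b)"] True show False by simp
  qed
  then show ?thesis using True by simp
next
  case False
  with assms(1) have c: "0 < c" by simp
  have "0 \<le> a + 2 * b * (- b / c) + c * (- b / c)\<^sup>2" by (rule assms)
  also have "\<dots> = a - b\<^sup>2 / c" using c by (simp add: field_simps power2_eq_square)
  finally show ?thesis using c by (simp add: field_simps)
qed

text \<open>The quadratic form at \<open>x + t y\<close> is a polynomial in \<open>t\<close> without
  negative values. The semidefinite version is the right one for the elimination below, where a
  diagonal entry may vanish.\<close>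

lemma psd_cauchy_schwarz:
  assumes K: "K \<in> carrier_mat n n" "psd_mat K" and x: "x \<in> carrier_vec n" and y: "y \<in> carrier_vec n"
  shows "(x \<bullet> (K *\<^sub>v y))\<^sup>2 \<le> (x \<bullet> (K *\<^sub>v x)) * (y \<bullet> (K *\<^sub>v y))"
proof (rule quadratic_nonneg_discriminant)
  show "0 \<le> y \<bullet> (K *\<^sub>v y)" using K y by (auto simp: psd_mat_iff)
next
  fix t :: real
  have s: "transpose_mat K = K" and p: "0 \<le> v \<bullet> (K *\<^sub>v v)" if "v \<in> carrier_vec n" for v
    using K that by (auto simp: psd_mat_iff)
  have yx: "y \<bullet> (K *\<^sub>v x) = x \<bullet> (K *\<^sub>v y)"
    using transpose_vec_mult_scalar[OF K(1) x y] comm_scalar_prod[of "K *\<^sub>v y" n x] s[OF x] K x y by auto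
  have "0 \<le> (x + t \<cdot>\<^sub>v y) \<bullet> (K *\<^sub>v (x + t \<cdot>\<^sub>v y))" using x y by (intro p) auto
  also have "K *\<^sub>v (x + t \<cdot>\<^sub>v y) = K *\<^sub>v x + t \<cdot>\<^sub>v (K *\<^sub>v y)"
    using K x y by (simp add: mult_add_distrib_mat_vec[of _ n n] mult_mat_vec[of _ n n])
  also have "(x + t \<cdot>\<^sub>v y) \<bullet> (K *\<^sub>v x + t \<cdot>\<^sub>v (K *\<^sub>v y)) =
      x \<bullet> (K *\<^sub>v x) + 2 * (x \<bullet> (K *\<^sub>v y)) * t + (y \<bullet> (K *\<^sub>v y)) * t\<^sup>2"
    using K x y yx by (simp add: add_scalar_prod_distrib[of _ n] scalar_prod_add_distrib[of _ n]
        power2_eq_square algebra_simps)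
  finally show "0 \<le> x \<bullet> (K *\<^sub>v x) + 2 * (x \<bullet> (K *\<^sub>v y)) * t + (y \<bullet> (K *\<^sub>v y)) * t\<^sup>2" .
qed

text \<open>A positive semidefinite matrix is a sum of matrices v v^T. The proof is a Cholesky
  elimination beginning with the last index, which avoids the spectral theorem; \<open>m\<close> is
  the size of the leading square outside of which \<open>K\<close> already vanishes.\<close>

lemma psd_outer_induct [consumes 2, case_names zero add]:
  assumes K: "K \<in> carrier_mat n n" "psd_mat K"
    and 0: "P (0\<^sub>m n n)"
    and add: "\<And>K v. K \<in> carrier_mat n n \<Longrightarrow> P K \<Longrightarrow> v \<in> carrier_vec n \<Longrightarrow> P (K + outer v v)"
  shows "P K"
proof -
  have "P K" if "K \<in> carrier_mat n n" "psd_mat K" "m \<le> n"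
    "\<And>i j. i < n \<Longrightarrow> j < n \<Longrightarrow> m \<le> i \<or> m \<le> j \<Longrightarrow> K $$ (i, j) = 0" for m K
    using that
  proof (induction m arbitrary: K)
    case 0
    then have "K = 0\<^sub>m n n" by (intro eq_matI) auto
    then show ?case using \<open>P (0\<^sub>m n n)\<close> by simp
  next
    case (Suc m)
    note K = Suc.prems(1) and psd = Suc.prems(2)
    have m: "m < n" using Suc.prems by simp
    define c where "c = K $$ (m, m)"
    have Ke: "K *\<^sub>v unit_vec n m = col K m" using K m by (intro eq_vecI) auto
    have sym: "K $$ (i, j) = K $$ (j, i)" if "i < n" "j < n" for i j
      using psd K that by (metis psd_mat_iff carrier_matD index_transpose_mat(1))
    \<comment> \<open>Cauchy-Schwarz against the unit vector \<open>m\<close>. For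
      \<open>c = 0\<close> it forces column \<open>m\<close> to vanish; for \<open>c > 0\<close> it
      says that the Schur complement \<open>L\<close> below is again positive semidefinite.\<close>
    have cs: "(x \<bullet> col K m)\<^sup>2 \<le> (x \<bullet> (K *\<^sub>v x)) * c" if "x \<in> carrier_vec n" for x
      using psd_cauchy_schwarz[OF K psd that, of "unit_vec n m"] K m by (simp add: Ke c_def)
    show ?case
    proof (cases "c = 0")
      case True
      have z: "K $$ (i, m) = 0" if "i < n" for i
        using cs[of "unit_vec n i"] that True K m by simp
      show ?thesis
      proof (rule Suc.IH[OF K psd])
        fix i j assume "i < n" "j < n" "m \<le> i \<or> m \<le> j"
        then show "K $$ (i, j) = 0" using Suc.prems(4)[of i j] z[of i] z[of j] sym[of i j] by (cases "i = m"; cases "j = m") auto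
      qed (use m in simp)
    next
      case False
      have "0 \<le> unit_vec n m \<bullet> (K *\<^sub>v unit_vec n m)" using psd K by (auto simp: psd_mat_iff)
      then have c: "0 < c" using False K m unfolding Ke by (simp add: c_def)
      \<comment> \<open>With this scaling \<open>outer v v\<close> agrees with \<open>K\<close> in
        row and column \<open>m\<close>, so subtracting it clears both.\<close>
      define v where "v = (1 / sqrt c) \<cdot>\<^sub>v col K m"
      have v: "v \<in> carrier_vec n" using K by (auto simp: v_def)
      define L where "L = mat n n (\<lambda>(i, j). K $$ (i, j) - v $ i * v $ j)"
      have L: "L \<in> carrier_mat n n" by (simp add: L_def)
      have KL: "K = L + outer v v" using K v by (intro eq_matI) (auto simp: L_def outer_def)
      have vv: "v $ i * v $ j = K $$ (i, m) * K $$ (j, m) / c" if "i < n" "j < n" for i j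
        using that K m c by (simp add: v_def)
      have "P L"
      proof (rule Suc.IH[OF L])
        have "transpose_mat L = L" using sym by (intro eq_matI) (auto simp: L_def)
        moreover have "0 \<le> x \<bullet> (L *\<^sub>v x)" if x: "x \<in> carrier_vec n" for x
        proof -
          have "x \<bullet> (K *\<^sub>v x) = x \<bullet> (L *\<^sub>v x) + (v \<bullet> x) * (x \<bullet> v)"
            unfolding KL using L v x by (simp add: add_mult_distrib_mat_vec[of _ n n]
                scalar_prod_add_distrib[of _ n] outer_mult_vec)
          moreover have "(v \<bullet> x) * (x \<bullet> v) = (x \<bullet> col K m)\<^sup>2 / c"
            using comm_scalar_prod[OF v x] x K c by (simp add: v_def power2_eq_square)
          moreover have "(x \<bullet> col K m)\<^sup>2 / c \<le> x \<bullet> (K *\<^sub>v x)" using cs[OF x] c by (simp add: field_simps)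
          ultimately show ?thesis by linarith
        qed
        ultimately show "psd_mat L" using psd_mat_iff[OF L] by blast
      next
        fix i j assume ij: "i < n" "j < n" "m \<le> i \<or> m \<le> j"
        have e: "L $$ (i, j) = K $$ (i, j) - K $$ (i, m) * K $$ (j, m) / c"
          using ij by (simp add: L_def vv)
        consider "i = m" | "j = m" | "Suc m \<le> i" | "Suc m \<le> j" using ij by linarith
        then show "L $$ (i, j) = 0"
        proof cases
          case 1
          then show ?thesis using e sym[OF ij(1,2)] c by (simp add: c_def)
        next
          case 2
          then show ?thesis using e c by (simp add: c_def)
        next
          case 3
          then show ?thesis using e Suc.prems(4)[OF ij(1,2)] Suc.prems(4)[OF ij(1) m] by simp
        next
          case 4
          then show ?thesis using e Suc.prems(4)[OF ij(1,2)] Suc.prems(4)[OF ij(2) m] by simp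
        qed
      qed (use m in simp)
      from add[OF L this v] show ?thesis unfolding KL[symmetric] .
    qed
  qed
  from this[OF K, of n] show ?thesis by auto
qed

subsection \<open>The Kronecker form of the Lyapunov map\<close>

text \<open>Columns are stacked: entry \<open>(i, j)\<close> sits at position
  \<open>j * n + i\<close>. In this order right multiplication by \<open>J\<close> becomes the
  tensor product of \<open>J^T\<close> with the identity, and left multiplication by
  \<open>J^T\<close> that of the identity with \<open>J^T\<close>.\<close>

definition vec_of_mat :: "nat \<Rightarrow> 'a mat \<Rightarrow> 'a vec" where
  "vec_of_mat n H = vec (n * n) (\<lambda>r. H $$ (r mod n, r div n))"

definition mat_of_vec :: "nat \<Rightarrow> 'a vec \<Rightarrow> 'a mat" where
  "mat_of_vec n v = mat n n (\<lambda>(i, j). v $ (j * n + i))"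

lemma mult_add_less:
  fixes i j m n :: nat
  assumes "j < m" "i < n"
  shows "j * n + i < m * n"
proof -
  have "j * n + i < Suc j * n" using assms by simp
  also have "\<dots> \<le> m * n" using assms by (intro mult_le_mono1) simp
  finally show ?thesis .
qed

lemma square_index_less:
  fixes r n :: nat
  assumes "r < n * n"
  shows "r mod n < n" "r div n < n"
proof -
  have "0 < n" using assms by (cases n) auto
  then show "r mod n < n" by simp
  show "r div n < n" using assms by (rule less_mult_imp_div_less)
qed

lemma vec_of_mat_carrier [simp]: "vec_of_mat n H \<in> carrier_vec (n * n)"
  by (simp add: vec_of_mat_def)

lemma dim_vec_of_mat [simp]: "dim_vec (vec_of_mat n H) = n * n"
  by (simp add: vec_of_mat_def)

lemma mat_of_vec_carrier [simp]: "mat_of_vec n v \<in> carrier_mat n n"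
  by (simp add: mat_of_vec_def)

lemma mat_of_vec_of_mat: "H \<in> carrier_mat n n \<Longrightarrow> mat_of_vec n (vec_of_mat n H) = H"
  by (intro eq_matI) (auto simp: vec_of_mat_def mat_of_vec_def mult_add_less)

lemma vec_of_mat_of_vec: "v \<in> carrier_vec (n * n) \<Longrightarrow> vec_of_mat n (mat_of_vec n v) = v"
  by (intro eq_vecI) (auto simp: vec_of_mat_def mat_of_vec_def square_index_less)

lemma sum_product_index:
  fixes f :: "nat \<Rightarrow> 'a :: comm_monoid_add"
  shows "(\<Sum>s = 0..<m * n. f s) = (\<Sum>j = 0..<m. \<Sum>i = 0..<n. f (j * n + i))"
proof -
  have "sum f {j * n..<j * n + n} = (\<Sum>i = 0..<n. f (j * n + i))" for j
    using sum.shift_bounds_nat_ivl[of f 0 "j * n" n] by (simp only: add_0 add_0_right add.commute[of _ "j * n"])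
  then show ?thesis using sum.nat_group[of f n m] by (simp add: lessThan_atLeast0)
qed

definition kron_sum :: "nat \<Rightarrow> 'a :: comm_ring_1 mat \<Rightarrow> 'a mat" where
  "kron_sum n J = transpose_mat J \<otimes>\<^sub>m 1\<^sub>m n + 1\<^sub>m n \<otimes>\<^sub>m transpose_mat J"

lemma kron_sum_carrier [simp]: "J \<in> carrier_mat n n \<Longrightarrow> kron_sum n J \<in> carrier_mat (n * n) (n * n)"
  by (simp add: kron_sum_def kron_def)

lemma kron_sum_mult_vec:
  fixes J :: "'a :: comm_ring_1 mat"
  assumes J: "J \<in> carrier_mat n n" and H: "H \<in> carrier_mat n n"
  shows "kron_sum n J *\<^sub>v vec_of_mat n H = vec_of_mat n (lyapunov_op J H)" (is "?M *\<^sub>v _ = _")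
proof (rule eq_vecI)
  fix r assume "r < dim_vec (vec_of_mat n (lyapunov_op J H))"
  then have r: "r < n * n" by simp
  define i j where "i = r mod n" and "j = r div n"
  have ij: "i < n" "j < n" using square_index_less[OF r] by (auto simp: i_def j_def)
  have "(?M *\<^sub>v vec_of_mat n H) $ r = (\<Sum>s = 0..<n * n. ?M $$ (r, s) * H $$ (s mod n, s div n))"
    using r J by (simp add: scalar_prod_def vec_of_mat_def kron_def kron_sum_def)
  also have "\<dots> = (\<Sum>l = 0..<n. \<Sum>k = 0..<n. ?M $$ (r, l * n + k) * H $$ (k, l))"
    by (simp add: sum_product_index)
  \<comment> \<open>Each Kronecker summand has an identity factor, which forces \<open>k = i\<close>
    in the first and \<open>l = j\<close> in the second.\<close>
  also have "\<dots> = (\<Sum>l = 0..<n. \<Sum>k = 0..<n. (if k = i then H $$ (i, l) * J $$ (l, j) else 0)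
      + (if l = j then J $$ (k, i) * H $$ (k, j) else 0))"
  proof (intro sum.cong refl)
    fix k l assume kl: "l \<in> {0..<n}" "k \<in> {0..<n}"
    then have "?M $$ (r, l * n + k) = J $$ (l, j) * (if k = i then 1 else 0) + (if l = j then 1 else 0) * J $$ (k, i)"
      using r J ij unfolding i_def j_def by (simp add: kron_def kron_sum_def mult_add_less)
    then show "?M $$ (r, l * n + k) * H $$ (k, l) = (if k = i then H $$ (i, l) * J $$ (l, j) else 0)
      + (if l = j then J $$ (k, i) * H $$ (k, j) else 0)"
      by (auto simp: algebra_simps)
  qed
  also have "\<dots> = (\<Sum>l = 0..<n. H $$ (i, l) * J $$ (l, j)) + (\<Sum>k = 0..<n. J $$ (k, i) * H $$ (k, j))"
  proof -
    have "(\<Sum>l = 0..<n. \<Sum>k = 0..<n. if l = j then J $$ (k, i) * H $$ (k, j) else 0)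
       = (\<Sum>l = 0..<n. if l = j then (\<Sum>k = 0..<n. J $$ (k, i) * H $$ (k, j)) else 0)"
      by (intro sum.cong) auto
    then show ?thesis using ij by (simp add: sum.distrib)
  qed
  also have "\<dots> = vec_of_mat n (lyapunov_op J H) $ r"
    using r J H ij by (simp add: vec_of_mat_def lyapunov_op_def scalar_prod_def flip: i_def j_def)
  finally show "(?M *\<^sub>v vec_of_mat n H) $ r = vec_of_mat n (lyapunov_op J H) $ r" .
qed (use J in \<open>simp add: kron_sum_def kron_def\<close>)

section \<open>The map \<Phi> of a pair of matrices\<close>

definition lyapunov_map :: "nat \<Rightarrow> real mat \<Rightarrow> real mat \<Rightarrow> real mat \<Rightarrow> real mat" where
  "lyapunov_map n J B K = mat_of_vec n (lyapunov_L J B *\<^sub>v vec_of_mat n K)"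

text \<open>Injectivity of \<open>lyapunov_op J\<close> takes the place of regularity, because it
  passes along a similarity without any discussion of spectra. In the end \<open>J\<close> is the
  Jordan form and \<open>B\<close> the conjugate \<open>Q B P\<close> of the given matrix.\<close>

locale lyapunov_pair =
  fixes n :: nat and J B :: "real mat"
  assumes J: "J \<in> carrier_mat n n" and B: "B \<in> carrier_mat n n"
    and inj: "\<And>H. H \<in> carrier_mat n n \<Longrightarrow> lyapunov_op J H = 0\<^sub>m n n \<Longrightarrow> H = 0\<^sub>m n n"
begin

abbreviation "kronJ \<equiv> kron_sum n J"

lemmas kronJ_carrier = kron_sum_carrier[OF J]

text \<open>A null vector of \<open>kronJ\<close>, read as a matrix, lies in the kernel of
  \<open>lyapunov_op J\<close>.\<close>

lemma kronJ_det: "det kronJ \<noteq> 0"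
proof
  assume "det kronJ = 0"
  then obtain v where v: "v \<in> carrier_vec (n * n)" "v \<noteq> 0\<^sub>v (n * n)" "kronJ *\<^sub>v v = 0\<^sub>v (n * n)"
    using det_0_iff_vec_prod_zero[OF kronJ_carrier] by auto
  let ?H = "mat_of_vec n v"
  have "vec_of_mat n (lyapunov_op J ?H) = 0\<^sub>v (n * n)"
    using kron_sum_mult_vec[OF J, of ?H] v by (simp add: vec_of_mat_of_vec)
  then have "lyapunov_op J ?H = mat_of_vec n (0\<^sub>v (n * n))"
    using mat_of_vec_of_mat[of "lyapunov_op J ?H" n] J by simp
  also have "\<dots> = 0\<^sub>m n n"
    by (intro eq_matI) (auto simp: mat_of_vec_def mult_add_less)
  finally have "?H = 0\<^sub>m n n" by (rule inj[OF mat_of_vec_carrier])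
  then have "v = vec_of_mat n (0\<^sub>m n n)" using vec_of_mat_of_vec[OF v(1)] by simp
  also have "\<dots> = 0\<^sub>v (n * n)"
    by (intro eq_vecI) (auto simp: vec_of_mat_def square_index_less)
  finally show False using v by simp
qed

lemmas kronJ_inv = mat_inv_eq[OF kronJ_carrier kronJ_det]

lemma lyapunov_L_eq: "lyapunov_L J B = kron_sum n B * mat_inv kronJ"
  using J by (simp add: lyapunov_L_def kron_sum_def Let_def)

lemma lyapunov_L_carrier: "lyapunov_L J B \<in> carrier_mat (n * n) (n * n)"
  using kronJ_inv(1) B by (auto simp: lyapunov_L_eq intro: mult_carrier_mat[of _ _ "n * n"])

lemma lyapunov_op_surj:
  assumes K: "K \<in> carrier_mat n n"
  obtains H where "H \<in> carrier_mat n n" "lyapunov_op J H = K"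
proof
  let ?v = "mat_inv kronJ *\<^sub>v vec_of_mat n K"
  have v: "?v \<in> carrier_vec (n * n)"
    using kronJ_inv(1) by (intro mult_mat_vec_carrier) auto
  show "mat_of_vec n ?v \<in> carrier_mat n n" by simp
  have "vec_of_mat n (lyapunov_op J (mat_of_vec n ?v)) = kronJ *\<^sub>v ?v"
    using kron_sum_mult_vec[OF J, of "mat_of_vec n ?v"] v by (simp add: vec_of_mat_of_vec)
  also have "\<dots> = vec_of_mat n K"
    using kronJ_inv kronJ_carrier
    by (simp flip: assoc_mult_mat_vec[of kronJ "n * n" "n * n" "mat_inv kronJ" "n * n"])
  finally show "lyapunov_op J (mat_of_vec n ?v) = K"
    using mat_of_vec_of_mat[OF K] mat_of_vec_of_mat[of "lyapunov_op J (mat_of_vec n ?v)" n] J by simp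
qed

abbreviation "\<Phi> \<equiv> lyapunov_map n J B"

lemma \<Phi>_carrier [simp]: "\<Phi> K \<in> carrier_mat n n"
  by (simp add: lyapunov_map_def)

text \<open>In coordinates \<Phi> is \<open>kron_sum n B\<close> after the inverse of
  \<open>kronJ\<close>, and that inverse cancels here. With the surjectivity of
  \<open>lyapunov_op J\<close> this yields the algebraic properties below: write each argument as
  \<open>lyapunov_op J H\<close> and compute with \<open>lyapunov_op B H\<close>.\<close>

lemma \<Phi>_lyapunov_op:
  assumes H: "H \<in> carrier_mat n n"
  shows "\<Phi> (lyapunov_op J H) = lyapunov_op B H"
proof -
  have "lyapunov_L J B *\<^sub>v vec_of_mat n (lyapunov_op J H) =
    kron_sum n B *\<^sub>v (mat_inv kronJ *\<^sub>v (kronJ *\<^sub>v vec_of_mat n H))"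
    using kronJ_inv(1) J B H
    by (simp add: lyapunov_L_eq kron_sum_mult_vec assoc_mult_mat_vec[of _ "n * n" "n * n" _ "n * n"])
  also have "mat_inv kronJ *\<^sub>v (kronJ *\<^sub>v vec_of_mat n H) = vec_of_mat n H"
    using kronJ_inv kronJ_carrier
    by (simp flip: assoc_mult_mat_vec[of "mat_inv kronJ" "n * n" "n * n" kronJ "n * n"])
  finally show ?thesis
    using B H by (simp add: lyapunov_map_def kron_sum_mult_vec mat_of_vec_of_mat)
qed

lemma \<Phi>_add:
  assumes "K \<in> carrier_mat n n" "L \<in> carrier_mat n n"
  shows "\<Phi> (K + L) = \<Phi> K + \<Phi> L"
proof -
  obtain H where H: "H \<in> carrier_mat n n" "lyapunov_op J H = K" using lyapunov_op_surj[OF assms(1)] .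
  obtain G where G: "G \<in> carrier_mat n n" "lyapunov_op J G = L" using lyapunov_op_surj[OF assms(2)] .
  have "\<Phi> (lyapunov_op J (H + G)) = \<Phi> (lyapunov_op J H) + \<Phi> (lyapunov_op J G)"
    using H(1) G(1) B by (simp add: \<Phi>_lyapunov_op lyapunov_op_add[of _ n])
  then show ?thesis using H G J by (simp add: lyapunov_op_add[of _ n])
qed

lemma \<Phi>_zero: "\<Phi> (0\<^sub>m n n) = 0\<^sub>m n n"
proof -
  have "lyapunov_op J (0\<^sub>m n n) = 0\<^sub>m n n" "lyapunov_op B (0\<^sub>m n n) = 0\<^sub>m n n"
    using J B by (auto simp: lyapunov_op_def)
  then show ?thesis using \<Phi>_lyapunov_op[of "0\<^sub>m n n"] by simp
qed

lemma \<Phi>_transpose: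
  assumes "K \<in> carrier_mat n n"
  shows "\<Phi> (transpose_mat K) = transpose_mat (\<Phi> K)"
proof -
  obtain H where H: "H \<in> carrier_mat n n" "lyapunov_op J H = K" using lyapunov_op_surj[OF assms] .
  show ?thesis
    using \<Phi>_lyapunov_op[of H] \<Phi>_lyapunov_op[of "transpose_mat H"] H(1) J B
    by (simp add: lyapunov_op_transpose[of _ n] flip: H(2))
qed

text \<open>The Lyapunov operators of \<open>J\<close> and of \<open>B\<close> both respect the
  action taking \<open>H\<close> to \<open>X^T H Y\<close>; hence so does \<Phi>, which turns the
  one into the other.\<close>

lemma \<Phi>_bimodule:
  assumes K: "K \<in> carrier_mat n n" and c: "X \<in> carrier_mat n n" "Y \<in> carrier_mat n n"
    and "J * X = X * J" "J * Y = Y * J" "B * X = X * B" "B * Y = Y * B"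
  shows "\<Phi> (transpose_mat X * K * Y) = transpose_mat X * \<Phi> K * Y"
proof -
  obtain H where H: "H \<in> carrier_mat n n" "lyapunov_op J H = K" using lyapunov_op_surj[OF K] .
  have "\<Phi> (transpose_mat X * K * Y) = \<Phi> (lyapunov_op J (transpose_mat X * H * Y))"
    using lyapunov_op_intertwine[of J n J X Y H] assms H J by simp
  also have "\<dots> = lyapunov_op B (transpose_mat X * H * Y)"
    using H c by (intro \<Phi>_lyapunov_op) simp
  also have "\<dots> = transpose_mat X * \<Phi> K * Y"
    using lyapunov_op_intertwine[of B n B X Y H] \<Phi>_lyapunov_op[of H] assms H B by simp
  finally show ?thesis .
qed

text \<open>The vectorised matrix unit at \<open>(b, j)\<close> is the unit vector at
  \<open>j * n + b\<close>, so it picks a column of \<open>L\<close>. Block indices thus become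
  column indices of the arguments and values of \<Phi>, inner indices their row indices.\<close>

lemma lyapunov_L_entry:
  assumes "i < n" "a < n" "j < n" "b < n"
  shows "lyapunov_L J B $$ (i * n + a, j * n + b) = \<Phi> (outer (unit_vec n b) (unit_vec n j)) $$ (a, i)"
proof -
  have "vec_of_mat n (outer (unit_vec n b) (unit_vec n j)) = (unit_vec (n * n) (j * n + b) :: real vec)"
  proof (rule eq_vecI)
    fix r assume "r < dim_vec (unit_vec (n * n) (j * n + b) :: real vec)"
    then have r: "r < n * n" by simp
    note square_index_less[OF r]
    moreover have "r = j * n + b \<longleftrightarrow> r mod n = b \<and> r div n = j"
      using assms div_mult_mod_eq[of r n] by auto
    ultimately show "vec_of_mat n (outer (unit_vec n b) (unit_vec n j)) $ r = (unit_vec (n * n) (j * n + b) :: real vec) $ r"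
      using r assms mult_add_less[of j n b n] by (auto simp: vec_of_mat_def)
  qed simp
  then show ?thesis
    using assms lyapunov_L_carrier mult_add_less[of j n b n] mult_add_less[of i n a n]
    by (simp add: lyapunov_map_def mat_of_vec_def)
qed

end

subsection \<open>Positivity and the Hill-Pick matrix\<close>

definition indicator_mat :: "nat \<Rightarrow> nat set \<Rightarrow> real mat" where
  "indicator_mat n S = mat n n (\<lambda>(r, c). if r = c \<and> r \<in> S then 1 else 0)"

lemma indicator_mat_carrier [simp]: "indicator_mat n S \<in> carrier_mat n n"
  by (simp add: indicator_mat_def)

lemma transpose_indicator_mat [simp]: "transpose_mat (indicator_mat n S) = indicator_mat n S"
  by (intro eq_matI) (auto simp: indicator_mat_def)

lemma indicator_mat_mult_vec:
  assumes "v \<in> carrier_vec n"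
  shows "indicator_mat n S *\<^sub>v v = vec n (\<lambda>i. if i \<in> S then v $ i else 0)"
proof (rule eq_vecI)
  fix i assume "i < dim_vec (vec n (\<lambda>i. if i \<in> S then v $ i else 0))"
  then have i: "i < n" by simp
  have "(indicator_mat n S *\<^sub>v v) $ i = (\<Sum>k = 0..<n. if k = i then (if i \<in> S then v $ i else 0) else 0)"
  proof -
    have "(indicator_mat n S *\<^sub>v v) $ i = (\<Sum>k = 0..<n. (if i = k \<and> i \<in> S then 1 else 0) * v $ k)"
      using i assms by (simp add: indicator_mat_def scalar_prod_def)
    also have "\<dots> = (\<Sum>k = 0..<n. if k = i then (if i \<in> S then v $ i else 0) else 0)"
      by (rule sum.cong) auto
    finally show ?thesis .
  qed
  also have "\<dots> = vec n (\<lambda>i. if i \<in> S then v $ i else 0) $ i" using i by simp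
  finally show "(indicator_mat n S *\<^sub>v v) $ i = vec n (\<lambda>i. if i \<in> S then v $ i else 0) $ i" .
qed (simp add: indicator_mat_def)

lemma indicator_mat_commute:
  assumes J: "J \<in> carrier_mat n n"
    and 0: "\<And>r c. r < n \<Longrightarrow> c < n \<Longrightarrow> r \<in> S \<longleftrightarrow> c \<notin> S \<Longrightarrow> J $$ (r, c) = 0"
  shows "J * indicator_mat n S = indicator_mat n S * J"
proof (rule eq_matI)
  fix r c assume "r < dim_row (indicator_mat n S * J)" "c < dim_col (indicator_mat n S * J)"
  then have rc: "r < n" "c < n" using J by (auto simp: indicator_mat_def)
  have "(J * indicator_mat n S) $$ (r, c) = (\<Sum>k = 0..<n. if k = c then (if c \<in> S then J $$ (r, c) else 0) else 0)"
  proof -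
    have "(J * indicator_mat n S) $$ (r, c) = (\<Sum>k = 0..<n. J $$ (r, k) * (if k = c \<and> k \<in> S then 1 else 0))"
      using rc J by (simp add: indicator_mat_def scalar_prod_def)
    also have "\<dots> = (\<Sum>k = 0..<n. if k = c then (if c \<in> S then J $$ (r, c) else 0) else 0)"
      by (rule sum.cong) auto
    finally show ?thesis .
  qed
  also have "\<dots> = (if c \<in> S then J $$ (r, c) else 0)" using rc by simp
  also have "\<dots> = (if r \<in> S then J $$ (r, c) else 0)" using 0[OF rc] by auto
  also have "\<dots> = (\<Sum>k = 0..<n. if k = r then (if r \<in> S then J $$ (r, c) else 0) else 0)" using rc by simp
  also have "\<dots> = (\<Sum>k = 0..<n. (if r = k \<and> r \<in> S then 1 else 0) * J $$ (k, c))"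
    by (rule sum.cong) auto
  also have "\<dots> = (indicator_mat n S * J) $$ (r, c)"
    using rc J by (simp add: indicator_mat_def scalar_prod_def)
  finally show "(J * indicator_mat n S) $$ (r, c) = (indicator_mat n S * J) $$ (r, c)" .
qed (use J in \<open>auto simp: indicator_mat_def\<close>)

lemma scalar_prod_unit_mult_unit:
  fixes F :: "'a :: comm_ring_1 mat"
  assumes "F \<in> carrier_mat n m" "i < n" "j < m"
  shows "unit_vec n i \<bullet> (F *\<^sub>v unit_vec m j) = F $$ (i, j)"
  using assms by simp

lemma smult_mat_mult_vec:
  fixes M :: "'a :: comm_ring_1 mat"
  assumes "M \<in> carrier_mat n m" "v \<in> carrier_vec m"
  shows "(a \<cdot>\<^sub>m M) *\<^sub>v v = a \<cdot>\<^sub>v (M *\<^sub>v v)"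
  using assms by (intro eq_vecI) (auto simp: scalar_prod_def sum_distrib_left mult.assoc)

text \<open>The entry pairs the images of the two unit vectors under \<open>X\<close> and
  \<open>Y\<close>. Applied to projections, it says that compressing \<open>F\<close> keeps the
  entries inside the compressed block.\<close>

lemma mult_eq_entry_of_fixed_units:
  fixes F :: "real mat"
  assumes "F \<in> carrier_mat n n" "X \<in> carrier_mat n n" "Y \<in> carrier_mat n n" "i < n" "j < n"
    and "X *\<^sub>v unit_vec n i = unit_vec n i" "Y *\<^sub>v unit_vec n j = unit_vec n j"
  shows "(transpose_mat X * F * Y) $$ (i, j) = F $$ (i, j)"
proof -
  have "(transpose_mat X * F * Y) $$ (i, j) = unit_vec n i \<bullet> ((transpose_mat X * F * Y) *\<^sub>v unit_vec n j)"
    using assms by (intro scalar_prod_unit_mult_unit[symmetric]) auto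
  also have "\<dots> = unit_vec n i \<bullet> (transpose_mat X *\<^sub>v (F *\<^sub>v unit_vec n j))"
    using assms by (subst mult_mat3_vec[of _ n n _ n _ n]) auto
  also have "\<dots> = unit_vec n i \<bullet> (F *\<^sub>v unit_vec n j)"
    using transpose_vec_mult_scalar[of "transpose_mat X" n n "F *\<^sub>v unit_vec n j" "unit_vec n i"] assms
    by (simp del: scalar_prod_left_unit)
  finally show ?thesis using assms by simp
qed

section \<open>Domination as positivity of \<Phi>\<close>

context lyapunov_pair
begin

text \<open>Domination quantifies over symmetric \<open>H\<close>, so preimages of symmetric
  matrices must be symmetric. The difference \<open>H^T - H\<close> lies in the kernel of
  \<open>lyapunov_op J\<close>.\<close>

lemma lyapunov_op_symmetric:
  assumes H: "H \<in> carrier_mat n n" and s: "transpose_mat (lyapunov_op J H) = lyapunov_op J H"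
  shows "transpose_mat H = H"
proof -
  let ?D = "transpose_mat H - H"
  have D: "?D \<in> carrier_mat n n" using H by (intro minus_carrier_mat)
  have e: "?D + H = transpose_mat H" using H by (intro eq_matI) auto
  have "lyapunov_op J ?D + lyapunov_op J H = lyapunov_op J H"
    using lyapunov_op_add[OF J D H] lyapunov_op_transpose[OF J H] s by (simp add: e)
  then have "lyapunov_op J ?D $$ (i, j) + lyapunov_op J H $$ (i, j) = lyapunov_op J H $$ (i, j)"
    if "i < n" "j < n" for i j
    using that index_add_mat(1)[of i "lyapunov_op J H" j "lyapunov_op J ?D"]
      lyapunov_op_carrier[OF J H] by (metis carrier_matD)
  then have "lyapunov_op J ?D = 0\<^sub>m n n"
    using lyapunov_op_carrier[OF J D] by (intro eq_matI) auto
  then have "?D = 0\<^sub>m n n" by (rule inj[OF D])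
  then show ?thesis using e H by simp
qed

text \<open>Substitute \<open>K = lyapunov_op J H\<close> in the definition; from left to right,
  \<open>lyapunov_op_symmetric\<close> supplies the symmetry of \<open>H\<close>.\<close>

lemma dominates_iff_positive:
  "lyapunov_dominates B J \<longleftrightarrow> (\<forall>K \<in> carrier_mat n n. psd_mat K \<longrightarrow> psd_mat (\<Phi> K))"
proof
  assume d: "lyapunov_dominates B J"
  show "\<forall>K \<in> carrier_mat n n. psd_mat K \<longrightarrow> psd_mat (\<Phi> K)"
  proof (intro ballI impI)
    fix K :: "real mat" assume K: "K \<in> carrier_mat n n" and p: "psd_mat K"
    obtain H where H: "H \<in> carrier_mat n n" "lyapunov_op J H = K" using lyapunov_op_surj[OF K] .
    have "symmetric_mat H"
      using lyapunov_op_symmetric[OF H(1)] p K H by (simp add: symmetric_mat_def psd_mat_iff)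
    then have "psd_mat (lyapunov_op B H)"
      using d H J p unfolding lyapunov_dominates_def lyapunov_op_def by auto
    then show "psd_mat (\<Phi> K)" using \<Phi>_lyapunov_op[OF H(1)] H by simp
  qed
next
  assume p: "\<forall>K \<in> carrier_mat n n. psd_mat K \<longrightarrow> psd_mat (\<Phi> K)"
  show "lyapunov_dominates B J"
    unfolding lyapunov_dominates_def lyapunov_op_def[symmetric]
    using p J \<Phi>_lyapunov_op lyapunov_op_carrier[OF J] by (metis carrier_matD(1))
qed

text \<open>By the bimodule property \<Phi> (v v^T) is a congruence transform of \<Phi> (u u^T), and
  every positive semidefinite matrix is a sum of such v v^T.\<close>

lemma positive_iff_of_cyclic:
  assumes u: "u \<in> carrier_vec n"
    and cyc: "\<And>v. v \<in> carrier_vec n \<Longrightarrow>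
      \<exists>X \<in> carrier_mat n n. J * X = X * J \<and> B * X = X * B \<and> transpose_mat X *\<^sub>v u = v"
  shows "lyapunov_dominates B J \<longleftrightarrow> psd_mat (\<Phi> (outer u u))"
  unfolding dominates_iff_positive
proof
  assume "\<forall>K \<in> carrier_mat n n. psd_mat K \<longrightarrow> psd_mat (\<Phi> K)"
  then show "psd_mat (\<Phi> (outer u u))" using psd_outer[OF u] u by simp
next
  assume p: "psd_mat (\<Phi> (outer u u))"
  have rank1: "psd_mat (\<Phi> (outer v v))" if v: "v \<in> carrier_vec n" for v
  proof -
    obtain X where X: "X \<in> carrier_mat n n" "J * X = X * J" "B * X = X * B" "transpose_mat X *\<^sub>v u = v"
      using cyc[OF v] by auto
    have "\<Phi> (outer v v) = transpose_mat X * \<Phi> (outer u u) * X"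
      using \<Phi>_bimodule[of "outer u u" X X] mult_outer_mult[of X n X u u] X u by simp
    then show ?thesis using psd_mat_congruence[OF \<Phi>_carrier X(1) p] by simp
  qed
  show "\<forall>K \<in> carrier_mat n n. psd_mat K \<longrightarrow> psd_mat (\<Phi> K)"
  proof (intro ballI impI)
    fix K :: "real mat" assume "K \<in> carrier_mat n n" and "psd_mat K"
    then show "psd_mat (\<Phi> K)"
    proof (induction rule: psd_outer_induct)
      case zero
      have "0\<^sub>m n n *\<^sub>v v = 0\<^sub>v n" if "v \<in> carrier_vec n" for v :: "real vec" using that by (intro eq_vecI) auto
      then show ?case by (simp add: \<Phi>_zero psd_mat_iff[of _ n])
    next
      case (add K v)
      then show ?case using rank1 by (simp add: \<Phi>_add psd_mat_add[of _ n])
    qed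
  qed
qed

text \<open>Here \<open>blk r\<close> identifies the diagonal block of \<open>J\<close> containing the index \<open>r\<close>, and \<open>us\<close> pairs every index
  of a largest block with the first index of that block.\<close>

theorem hill_pick_criterion:
  fixes us :: "(nat \<times> nat) list" and blk :: "nat \<Rightarrow> nat"
  assumes bicomm: "\<And>X. X \<in> carrier_mat n n \<Longrightarrow> J * X = X * J \<Longrightarrow> B * X = X * B"
    and blk: "\<And>r c. r < n \<Longrightarrow> c < n \<Longrightarrow> blk r \<noteq> blk c \<Longrightarrow> J $$ (r, c) = 0"
    and us_less: "\<And>i p. (i, p) \<in> set us \<Longrightarrow> i < n \<and> p < n \<and> blk i = blk p"
    and us_full: "\<And>i p r. (i, p) \<in> set us \<Longrightarrow> r < n \<Longrightarrow> blk r = blk p \<Longrightarrow> (r, p) \<in> set us"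
    and us_unique: "\<And>i p j q. (i, p) \<in> set us \<Longrightarrow> (j, q) \<in> set us \<Longrightarrow> blk p = blk q \<Longrightarrow> p = q"
    and us_distinct: "distinct (map fst us)"
    and cyclic: "\<And>p. p < n \<Longrightarrow> \<exists>X \<in> carrier_mat n n. \<exists>q \<in> snd ` set us. J * X = X * J \<and>
      (\<forall>r \<in> snd ` set us. \<forall>c < n. X $$ (r, c) = (if r = q \<and> c = p then 1 else 0))"
  defines "H \<equiv> hill_pick_sub n (lyapunov_L J B) us us"
  shows "transpose_mat H = H" "lyapunov_dominates B J \<longleftrightarrow> psd_mat H"
proof -
  define w where "w = length us"
  \<comment> \<open>\<open>U\<close> holds one index for each listed block, \<open>u\<close> is the
    sum of the unit vectors at these indices, and \<open>F\<close> is the one matrix on which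
    positivity is tested.\<close>
  define U where "U = snd ` set us"
  define u where "u = vec n (\<lambda>r. if r \<in> U then 1 else 0 :: real)"
  define F where "F = \<Phi> (outer u u)"
  have u: "u \<in> carrier_vec n" by (simp add: u_def)
  have F: "F \<in> carrier_mat n n" by (simp add: F_def)
  have Ft: "transpose_mat F = F"
    using \<Phi>_transpose[of "outer u u"] u by (simp add: F_def transpose_outer)
  have Fsym: "F $$ (i, j) = F $$ (j, i)" if "i < n" "j < n" for i j
    using Ft F that by (metis carrier_matD index_transpose_mat(1))
  have nth: "us ! k = (fst (us ! k), snd (us ! k))" "(fst (us ! k), snd (us ! k)) \<in> set us" if "k < w" for k
    using that by (auto simp: w_def)
  have less: "fst (us ! k) < n" "snd (us ! k) < n" "blk (fst (us ! k)) = blk (snd (us ! k))" if "k < w" for k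
    using us_less[OF nth(2)[OF that]] by auto

  \<comment> \<open>Cyclicity of \<open>u\<close>. As \<open>X^T u\<close> is linear in
    \<open>X\<close>, it is enough to reach the unit vectors; the induction assembles
    \<open>v\<close> from them, with \<open>m\<close> bounding its support.\<close>
  have "\<exists>X \<in> carrier_mat n n. J * X = X * J \<and> transpose_mat X *\<^sub>v u = v" if v: "v \<in> carrier_vec n" for v
  proof -
    have "\<exists>X \<in> carrier_mat n n. J * X = X * J \<and> transpose_mat X *\<^sub>v u = v"
      if "m \<le> n" "v \<in> carrier_vec n" "\<And>i. m \<le> i \<Longrightarrow> i < n \<Longrightarrow> v $ i = 0" for m v
      using that
    proof (induction m arbitrary: v)
      case 0
      then have "v = 0\<^sub>v n" by (intro eq_vecI) auto
      then show ?case using J u by (intro bexI[of _ "0\<^sub>m n n"]) auto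
    next
      case (Suc m)
      define v' where "v' = vec n (\<lambda>i. if i = m then 0 else v $ i)"
      have "\<exists>X \<in> carrier_mat n n. J * X = X * J \<and> transpose_mat X *\<^sub>v u = v'"
        using Suc.prems by (intro Suc.IH) (auto simp: v'_def)
      then obtain X where X: "X \<in> carrier_mat n n" "J * X = X * J" "transpose_mat X *\<^sub>v u = v'" by auto
      obtain Y q where Y: "Y \<in> carrier_mat n n" "J * Y = Y * J" and q: "q \<in> U"
        and Yrow: "\<And>r c. r \<in> U \<Longrightarrow> c < n \<Longrightarrow> Y $$ (r, c) = (if r = q \<and> c = m then 1 else 0)"
        using cyclic[of m] Suc.prems(1) unfolding U_def by auto
      have qn: "q < n" using q us_less by (auto simp: U_def)
      \<comment> \<open>Only rows of \<open>Y\<close> with index in \<open>U\<close> enter, and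
        among these only row \<open>q\<close> is non-zero; it is the unit row at
        \<open>m\<close>.\<close>
      have Yu: "transpose_mat Y *\<^sub>v u = unit_vec n m"
      proof (rule eq_vecI)
        fix c assume "c < dim_vec (unit_vec n m :: real vec)"
        then have c: "c < n" by simp
        have "(transpose_mat Y *\<^sub>v u) $ c = (\<Sum>r = 0..<n. if r = q then (if c = m then 1 else 0) else 0)"
        proof -
          have "(transpose_mat Y *\<^sub>v u) $ c = (\<Sum>r = 0..<n. Y $$ (r, c) * (if r \<in> U then 1 else 0))"
            using c Y by (simp add: scalar_prod_def u_def)
          also have "\<dots> = (\<Sum>r = 0..<n. if r = q then (if c = m then 1 else 0) else 0)"
            using c q Yrow by (intro sum.cong) auto
          finally show ?thesis .
        qed
        also have "\<dots> = unit_vec n m $ c" using c qn by (simp add: unit_vec_def)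
        finally show "(transpose_mat Y *\<^sub>v u) $ c = unit_vec n m $ c" .
      qed (use Y in simp)
      define Z where "Z = X + v $ m \<cdot>\<^sub>m Y"
      have Z: "Z \<in> carrier_mat n n" using X Y by (simp add: Z_def)
      have "J * Z = Z * J"
        using X Y J by (simp add: Z_def mult_add_distrib_mat[where nr=n and n=n and nc=n]
            add_mult_distrib_mat[where nr=n and n=n and nc=n] mult_smult_distrib[where nr=n and n=n and nc=n]
            mult_smult_assoc_mat[where nr=n and n=n and nc=n])
      moreover have "transpose_mat Z *\<^sub>v u = v"
      proof -
        have "transpose_mat Z = transpose_mat X + v $ m \<cdot>\<^sub>m transpose_mat Y"
          using X Y by (intro eq_matI) (auto simp: Z_def)
        then have "transpose_mat Z *\<^sub>v u = v' + v $ m \<cdot>\<^sub>v unit_vec n m"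
          using X Y u by (simp add: add_mult_distrib_mat_vec[where nr=n and nc=n] smult_mat_mult_vec[where n=n and m=n] Yu)
        also have "\<dots> = v" using Suc.prems by (intro eq_vecI) (auto simp: v'_def)
        finally show ?thesis .
      qed
      ultimately show ?case using Z by auto
    qed
    from this[of n v] v show ?thesis by auto
  qed
  then have dom: "lyapunov_dominates B J \<longleftrightarrow> psd_mat F"
    unfolding F_def using bicomm by (intro positive_iff_of_cyclic[OF u]) blast

  have proj: "J * indicator_mat n {r. blk r = b} = indicator_mat n {r. blk r = b} * J" for b
    by (intro indicator_mat_commute[OF J] blk) auto
  \<comment> \<open>A block contains at most one element of \<open>U\<close>, so projecting onto the
    block of \<open>p\<close> isolates the summand of \<open>u\<close> at \<open>p\<close>.\<close>
  have proj_u: "indicator_mat n {r. blk r = blk p} *\<^sub>v u = unit_vec n p" if p: "p \<in> U" for p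
  proof -
    have "p < n" using p us_less by (auto simp: U_def)
    moreover have "r \<in> U \<and> blk r = blk p \<longleftrightarrow> r = p" for r
      using p us_unique by (force simp: U_def)
    ultimately show ?thesis
      unfolding indicator_mat_mult_vec[OF u] by (intro eq_vecI) (auto simp: u_def unit_vec_def)
  qed
  \<comment> \<open>The matrix unit behind this entry of \<open>L\<close> is
    \<open>outer u u\<close> compressed by two block projections, which move out of \<Phi>. The
    entry read off lies in the blocks kept, so the compression does not change it. The two indices
    come out exchanged; the symmetry of \<open>F\<close> repairs this later.\<close>
  have entry: "H $$ (k, l) = F $$ (fst (us ! l), fst (us ! k))" if kl: "k < w" "l < w" for k l
  proof -
    obtain ik jk where k: "us ! k = (ik, jk)" by (cases "us ! k")
    obtain il jl where l: "us ! l = (il, jl)" by (cases "us ! l")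
    note L = less[OF kl(1), unfolded k fst_conv snd_conv] less[OF kl(2), unfolded l fst_conv snd_conv]
    have U: "jk \<in> U" "jl \<in> U"
      using nth(2)[OF kl(1)] nth(2)[OF kl(2)] k l by (force simp: U_def)+
    let ?X = "indicator_mat n {r. blk r = blk jl}" and ?Y = "indicator_mat n {r. blk r = blk jk}"
    have "H $$ (k, l) = lyapunov_L J B $$ (ik * n + il, jk * n + jl)"
      using kl k l L by (simp add: H_def hill_pick_sub_def nth_block_def w_def)
    also have "\<dots> = \<Phi> (outer (unit_vec n jl) (unit_vec n jk)) $$ (il, ik)"
      using L by (simp add: lyapunov_L_entry)
    also have "outer (unit_vec n jl) (unit_vec n jk) = transpose_mat ?X * outer u u * ?Y"
      using mult_outer_mult[of ?X n ?Y u u] u U by (simp add: proj_u)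
    also have "\<Phi> \<dots> = transpose_mat ?X * F * ?Y"
      unfolding F_def using u proj bicomm by (intro \<Phi>_bimodule) auto
    also have "\<dots> $$ (il, ik) = F $$ (il, ik)"
      using F L by (intro mult_eq_entry_of_fixed_units) (auto simp: indicator_mat_mult_vec)
    finally show ?thesis using k l by simp
  qed

  \<comment> \<open>\<open>S\<close> selects coordinates: its column \<open>k\<close> is the unit
    vector at \<open>fst (us ! k)\<close>.\<close>
  define S where "S = mat n w (\<lambda>(r, k). if r = fst (us ! k) then 1 else 0 :: real)"
  have S: "S \<in> carrier_mat n w" by (simp add: S_def)
  have Hc: "H \<in> carrier_mat w w" by (simp add: H_def hill_pick_sub_def w_def)
  have Scol: "S *\<^sub>v unit_vec w k = unit_vec n (fst (us ! k))" if "k < w" for k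
    using that S less[OF that] by (auto simp: S_def intro!: eq_vecI)
  have HS: "H = transpose_mat S * F * S"
  proof (rule eq_matI)
    fix k l assume "k < dim_row (transpose_mat S * F * S)" "l < dim_col (transpose_mat S * F * S)"
    then have kl: "k < w" "l < w" using S by auto
    have "(transpose_mat S * F * S) $$ (k, l) = unit_vec w k \<bullet> ((transpose_mat S * F * S) *\<^sub>v unit_vec w l)"
      using S F kl by (intro scalar_prod_unit_mult_unit[symmetric]) auto
    also have "\<dots> = unit_vec w k \<bullet> (transpose_mat S *\<^sub>v (F *\<^sub>v unit_vec n (fst (us ! l))))"
      using S F kl by (subst mult_mat3_vec[of _ w n _ n _ w]) (auto simp: Scol)
    also have "\<dots> = unit_vec n (fst (us ! k)) \<bullet> (F *\<^sub>v unit_vec n (fst (us ! l)))"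
      using transpose_vec_mult_scalar[of "transpose_mat S" w n "F *\<^sub>v unit_vec n (fst (us ! l))" "unit_vec w k"]
        S F kl less by (simp add: Scol del: scalar_prod_left_unit)
    also have "\<dots> = F $$ (fst (us ! k), fst (us ! l))"
      using F kl less by (intro scalar_prod_unit_mult_unit) auto
    finally show "H $$ (k, l) = (transpose_mat S * F * S) $$ (k, l)"
      using entry[OF kl] Fsym less kl by simp
  qed (use Hc S in auto)
  \<comment> \<open>Distinctness of the first components rules out multiplicities, so this is a
    projection.\<close>
  have SS: "S * transpose_mat S = indicator_mat n (fst ` set us)"
  proof (rule eq_matI)
    fix r c assume "r < dim_row (indicator_mat n (fst ` set us))" "c < dim_col (indicator_mat n (fst ` set us))"
    then have rc: "r < n" "c < n" by (auto simp: indicator_mat_def)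
    have e: "(S * transpose_mat S) $$ (r, c) = (\<Sum>k = 0..<w. if r = fst (us ! k) \<and> c = fst (us ! k) then 1 else 0)"
      using rc by (auto simp: S_def scalar_prod_def intro!: sum.cong)
    show "(S * transpose_mat S) $$ (r, c) = indicator_mat n (fst ` set us) $$ (r, c)"
    proof (cases "r = c \<and> r \<in> fst ` set us")
      case True
      then obtain k where k: "k < w" "r = fst (us ! k)" by (auto simp: w_def in_set_conv_nth)
      have "k' = k" if "k' < w" "r = fst (us ! k')" for k'
        using that k us_distinct nth_eq_iff_index_eq[OF us_distinct, of k' k] by (simp add: w_def)
      then have "(S * transpose_mat S) $$ (r, c) = (\<Sum>k' = 0..<w. if k' = k then 1 else 0)"
        unfolding e using k True by (intro sum.cong) auto
      then have "(S * transpose_mat S) $$ (r, c) = 1" using k by simp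
      then show ?thesis using conjunct1[OF True] conjunct2[OF True] rc by (simp add: indicator_mat_def)
    next
      case False
      then show ?thesis unfolding e using rc by (auto simp: indicator_mat_def w_def intro!: sum.neutral)
    qed
  qed (use S in \<open>auto simp: indicator_mat_def\<close>)
  let ?E = "indicator_mat n (fst ` set us)"
  \<comment> \<open>By \<open>us_full\<close> the selected index set is a union of whole
    blocks.\<close>
  have comm_E: "J * ?E = ?E * J"
  proof (rule indicator_mat_commute[OF J])
    fix r c assume rc: "r < n" "c < n" and d: "r \<in> fst ` set us \<longleftrightarrow> c \<notin> fst ` set us"
    have full: "c' \<in> fst ` set us" if "r' \<in> fst ` set us" "c' < n" "blk r' = blk c'" for r' c'
    proof -
      obtain p where "(r', p) \<in> set us" using \<open>r' \<in> fst ` set us\<close> by auto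
      then have "(c', p) \<in> set us" using us_full[of r' p c'] us_less[of r' p] that by auto
      then show ?thesis by force
    qed
    have "r \<in> fst ` set us \<longleftrightarrow> c \<in> fst ` set us" if "blk r = blk c"
      using full[of r c] full[of c r] rc that by auto
    then show "J $$ (r, c) = 0" using d blk[OF rc] by auto
  qed
  have "U \<subseteq> fst ` set us"
  proof
    fix p assume "p \<in> U"
    then obtain i where i: "(i, p) \<in> set us" by (auto simp: U_def)
    then have "(p, p) \<in> set us" using us_full[OF i, of p] us_less[OF i] by simp
    then show "p \<in> fst ` set us" by force
  qed
  then have Eu: "?E *\<^sub>v u = u"
    unfolding indicator_mat_mult_vec[OF u] by (intro eq_vecI) (auto simp: u_def)
  \<comment> \<open>Since \<open>?E\<close> fixes \<open>u\<close>, the matrix \<open>F\<close>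
    equals its own compression and vanishes outside the selected indices. So \<open>F\<close> can be
    recovered from \<open>H\<close>, and semidefiniteness passes both ways.\<close>
  have "F = \<Phi> (transpose_mat ?E * outer u u * ?E)"
    using mult_outer_mult[of ?E n ?E u u] u by (simp add: Eu F_def)
  also have "\<dots> = transpose_mat ?E * F * ?E"
    unfolding F_def using u comm_E bicomm by (intro \<Phi>_bimodule) auto
  also have "\<dots> = (S * transpose_mat S) * F * (S * transpose_mat S)" by (simp add: SS)
  also have "\<dots> = transpose_mat (transpose_mat S) * H * transpose_mat S"
  proof -
    have 1: "(S * transpose_mat S) * F * (S * transpose_mat S) = (S * transpose_mat S) * F * S * transpose_mat S"
      using S F by (intro assoc_mult_mat[symmetric]) auto
    have 2: "(S * transpose_mat S) * F = S * (transpose_mat S * F)"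
      using S F by (intro assoc_mult_mat) auto
    have 3: "S * (transpose_mat S * F) * S = S * (transpose_mat S * F * S)"
      using S F by (intro assoc_mult_mat) auto
    show ?thesis unfolding HS using 1 2 3 by (metis transpose_transpose)
  qed
  finally have FH: "F = transpose_mat (transpose_mat S) * H * transpose_mat S" .
  show Ht: "transpose_mat H = H"
    using Hc entry Fsym less by (intro eq_matI) auto
  have "psd_mat F \<longleftrightarrow> psd_mat H"
  proof
    assume "psd_mat F"
    then show "psd_mat H" unfolding HS using S by (intro psd_mat_congruence[OF F]) auto
  next
    assume "psd_mat H"
    then have "psd_mat (transpose_mat (transpose_mat S) * H * transpose_mat S)"
      using S by (intro psd_mat_congruence[OF Hc]) auto
    then show "psd_mat F" using FH by simp
  qed
  with dom show "lyapunov_dominates B J \<longleftrightarrow> psd_mat H" by simp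
qed

end

subsection \<open>Block coordinates and intertwiners\<close>

text \<open>Together with \<open>locate_offset\<close> this makes \<open>locate\<close> inverse to
  the passage from \<open>(a, k)\<close> to \<open>sum_list (take a rs) + k\<close>, so that matrix
  indices can be traded for block coordinates.\<close>

lemma locate_less:
  assumes "i < sum_list rs" "locate rs i = (a, k)"
  shows "a < length rs \<and> k < rs ! a \<and> i = sum_list (take a rs) + k"
  using assms
proof (induction rs arbitrary: i a)
  case (Cons r rs)
  show ?case
  proof (cases "i < r")
    case False
    obtain a' where a': "locate rs (i - r) = (a', k)" "a = Suc a'"
      using Cons.prems(2) False by (auto split: prod.splits)
    have "i - r < sum_list rs" using Cons.prems(1) False by auto
    from Cons.IH[OF this a'(1)] show ?thesis using a'(2) False by auto
  qed (use Cons.prems in auto)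
qed simp

lemma locate_offset:
  "a < length rs \<Longrightarrow> k < rs ! a \<Longrightarrow> locate rs (sum_list (take a rs) + k) = (a, k)"
proof (induction rs arbitrary: a)
  case (Cons r rs)
  then show ?case by (cases a) auto
qed simp

lemma offset_less:
  fixes rs :: "nat list"
  shows "a < length rs \<Longrightarrow> k < rs ! a \<Longrightarrow> sum_list (take a rs) + k < sum_list rs"
proof (induction rs arbitrary: a)
  case (Cons r rs)
  then show ?case by (cases a) auto
qed simp

lemma sum_locate:
  fixes f :: "nat \<Rightarrow> 'a :: comm_monoid_add"
  shows "(\<Sum>i = 0..<sum_list rs. f i) = (\<Sum>a = 0..<length rs. \<Sum>k = 0..<rs ! a. f (sum_list (take a rs) + k))"
proof (induction rs arbitrary: f)
  case (Cons r rs)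
  have "(\<Sum>i = 0..<r + sum_list rs. f i) = (\<Sum>i = 0..<r. f i) + (\<Sum>i = r..<r + sum_list rs. f i)"
    by (rule sum.atLeastLessThan_concat[symmetric]) auto
  also have "(\<Sum>i = r..<r + sum_list rs. f i) = (\<Sum>i = 0..<sum_list rs. f (r + i))"
    using sum.shift_bounds_nat_ivl[of f 0 r "sum_list rs"] by (simp only: add_0 add_0_right add.commute[of _ r])
  finally show ?case
    using Cons.IH[of "\<lambda>i. f (r + i)"]
    by (simp add: sum.atLeast0_lessThan_Suc_shift add.assoc del: sum.op_ivl_Suc)
qed simp

text \<open>\<open>locate\<close> peels off the leading block exactly as
  \<open>diag_block_mat\<close> does, so induction on the list of blocks compares the two.\<close>

lemma index_diag_block_mat:
  assumes "\<forall>M \<in> set Bs. square_mat M"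
    and "i < sum_list (map dim_row Bs)" "j < sum_list (map dim_row Bs)"
    and "locate (map dim_row Bs) i = (a, k)" "locate (map dim_row Bs) j = (b, l)"
  shows "diag_block_mat Bs $$ (i, j) = (if a = b then Bs ! a $$ (k, l) else 0)"
  using assms
proof (induction Bs arbitrary: i j a b)
  case (Cons M Bs)
  let ?D = "diag_block_mat Bs" and ?d = "dim_row M"
  have D: "dim_row ?D = sum_list (map dim_row Bs)" "dim_col ?D = sum_list (map dim_row Bs)"
    using diag_block_mat_square[of Bs] Cons.prems(1) by (auto simp: dim_diag_block_mat)
  have M: "dim_col M = ?d" using Cons.prems(1) by simp
  have e: "diag_block_mat (M # Bs) $$ (i, j) = (if i < ?d then if j < ?d then M $$ (i, j) else 0
      else if j < ?d then 0 else ?D $$ (i - ?d, j - ?d))"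
    using Cons.prems(2,3) D M by (auto simp: Let_def)
  show ?case
  proof (cases "i < ?d \<or> j < ?d")
    case True
    then show ?thesis using e Cons.prems(4,5) by (auto split: prod.splits if_splits)
  next
    case False
    then obtain a' b' where *: "locate (map dim_row Bs) (i - ?d) = (a', k)" "a = Suc a'"
      "locate (map dim_row Bs) (j - ?d) = (b', l)" "b = Suc b'"
      using Cons.prems(4,5) by (auto split: prod.splits)
    then show ?thesis using Cons.IH[of "i - ?d" "j - ?d" a' b'] Cons.prems(1-3) False e by auto
  qed
qed simp

lemma concat_nth_locate:
  assumes "i < length (concat xss)" "locate (map length xss) i = (a, k)"
  shows "a < length xss \<and> k < length (xss ! a) \<and> concat xss ! i = xss ! a ! k"
  using assms
proof (induction xss arbitrary: i a)
  case (Cons xs xss)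
  show ?case
  proof (cases "i < length xs")
    case False
    obtain a' where a': "locate (map length xss) (i - length xs) = (a', k)" "a = Suc a'"
      using Cons.prems(2) False by (auto split: prod.splits)
    show ?thesis using Cons.IH[OF _ a'(1)] Cons.prems(1) a'(2) False by (auto simp: nth_append)
  qed (use Cons.prems in \<open>auto simp: nth_append\<close>)
qed simp

section \<open>Kronecker products and intertwiners of Jordan blocks\<close>

lemma kron_carrier [simp]:
  "A \<in> carrier_mat m n \<Longrightarrow> B \<in> carrier_mat p q \<Longrightarrow> A \<otimes>\<^sub>m B \<in> carrier_mat (m * p) (n * q)"
  by (auto simp: kron_def)

text \<open>The mixed-product rule: splitting the inner index as \<open>x * q + y\<close> factors
  the sum.\<close>

lemma kron_mult_kron:
  fixes A B C D :: "'a :: comm_ring_1 mat"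
  assumes c: "A \<in> carrier_mat m n" "B \<in> carrier_mat p q" "C \<in> carrier_mat n r" "D \<in> carrier_mat q s"
  shows "(A \<otimes>\<^sub>m B) * (C \<otimes>\<^sub>m D) = (A * C) \<otimes>\<^sub>m (B * D)"
proof (rule eq_matI)
  fix i j assume "i < dim_row ((A * C) \<otimes>\<^sub>m (B * D))" "j < dim_col ((A * C) \<otimes>\<^sub>m (B * D))"
  then have ij: "i < m * p" "j < r * s" using c by (auto simp: kron_def)
  then have pos: "0 < p" "0 < s" by (auto intro: gr0I)
  have I: "i div p < m" "i mod p < p" "j div s < r" "j mod s < s"
    using ij pos by (auto simp: less_mult_imp_div_less)
  have "((A \<otimes>\<^sub>m B) * (C \<otimes>\<^sub>m D)) $$ (i, j) = (\<Sum>l = 0..<n * q. (A \<otimes>\<^sub>m B) $$ (i, l) * (C \<otimes>\<^sub>m D) $$ (l, j))"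
    using ij c by (simp add: scalar_prod_def kron_def)
  also have "\<dots> = (\<Sum>x = 0..<n. \<Sum>y = 0..<q. (A \<otimes>\<^sub>m B) $$ (i, x * q + y) * (C \<otimes>\<^sub>m D) $$ (x * q + y, j))"
    by (rule sum_product_index)
  also have "\<dots> = (\<Sum>x = 0..<n. \<Sum>y = 0..<q. (A $$ (i div p, x) * C $$ (x, j div s)) * (B $$ (i mod p, y) * D $$ (y, j mod s)))"
    using ij c by (intro sum.cong) (auto simp: kron_def mult_add_less)
  also have "\<dots> = (\<Sum>x = 0..<n. A $$ (i div p, x) * C $$ (x, j div s)) * (\<Sum>y = 0..<q. B $$ (i mod p, y) * D $$ (y, j mod s))"
    by (simp add: sum_product)
  also have "\<dots> = (A * C) $$ (i div p, j div s) * (B * D) $$ (i mod p, j mod s)"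
    using I c by (simp add: scalar_prod_def)
  also have "\<dots> = ((A * C) \<otimes>\<^sub>m (B * D)) $$ (i, j)"
    using ij c by (simp add: kron_def del: index_mult_mat(1))
  finally show "((A \<otimes>\<^sub>m B) * (C \<otimes>\<^sub>m D)) $$ (i, j) = ((A * C) \<otimes>\<^sub>m (B * D)) $$ (i, j)" .
qed (use c in \<open>auto simp: kron_def\<close>)

text \<open>A rectangular piece of the \<open>q\<close>-th power of the upper shift. For
  \<open>q < k\<close> and \<open>0 < m\<close> its row 0 is the unit row at \<open>q\<close>, as
  required of the intertwiners below.\<close>

definition shift_mat :: "nat \<Rightarrow> nat \<Rightarrow> nat \<Rightarrow> real mat" where
  "shift_mat m k q = mat m k (\<lambda>(i, j). if j = i + q then 1 else 0)"

lemma shift_mat_carrier [simp]: "shift_mat m k q \<in> carrier_mat m k"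
  by (simp add: shift_mat_def)

lemma jordan_block_mult_shift:
  assumes "k \<le> m"
  shows "jordan_block m t * shift_mat m k q = shift_mat m k q * jordan_block k t"
proof (rule eq_matI)
  fix i j assume "i < dim_row (shift_mat m k q * jordan_block k t)" "j < dim_col (shift_mat m k q * jordan_block k t)"
  then have ij: "i < m" "j < k" by (auto simp: shift_mat_def)
  let ?W = "shift_mat m k q"
  have "(jordan_block m t * ?W) $$ (i, j) = (\<Sum>l = 0..<m. jordan_block m t $$ (i, l) * ?W $$ (l, j))"
    using ij by (simp add: scalar_prod_def shift_mat_def)
  also have "\<dots> = (\<Sum>l = 0..<m. (if l = i then t * ?W $$ (i, j) else 0) + (if l = Suc i then ?W $$ (Suc i, j) else 0))"
    using ij by (intro sum.cong) (auto simp: jordan_block_def)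
  also have "\<dots> = t * ?W $$ (i, j) + (if Suc i < m then ?W $$ (Suc i, j) else 0)"
    using ij by (simp add: sum.distrib)
  \<comment> \<open>Both sides test \<open>j = i + 1 + q\<close>. At the boundary,
    \<open>j = 0\<close> fails the test and \<open>i = m - 1\<close> would need
    \<open>j = m + q\<close>, impossible as \<open>j < k\<close> and
    \<open>k \<le> m\<close>.\<close>
  also have "\<dots> = t * ?W $$ (i, j) + (if 0 < j then ?W $$ (i, j - 1) else 0)"
    using ij assms by (auto simp: shift_mat_def)
  also have "\<dots> = (\<Sum>l = 0..<k. (if l = j then t * ?W $$ (i, j) else 0) + (if l = j - 1 then (if 0 < j then ?W $$ (i, j - 1) else 0) else 0))"
    using ij by (simp add: sum.distrib)
  also have "\<dots> = (\<Sum>l = 0..<k. ?W $$ (i, l) * jordan_block k t $$ (l, j))"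
    using ij by (intro sum.cong) (auto simp: jordan_block_def)
  also have "\<dots> = (?W * jordan_block k t) $$ (i, j)"
    using ij by (simp add: scalar_prod_def shift_mat_def)
  finally show "(jordan_block m t * ?W) $$ (i, j) = (?W * jordan_block k t) $$ (i, j)" .
qed (auto simp: shift_mat_def)

lemma C_mat_carrier [simp]: "C_mat l \<in> carrier_mat 2 2"
  by (simp add: C_mat_def mat_of_rows_list_def numeral_2_eq_2)

lemma index_C_mat:
  assumes "i < 2" "j < 2"
  shows "C_mat l $$ (i, j) = (if i = j then Re l else if i = 0 then Im l else - Im l)"
  using assms by (auto simp: C_mat_def mat_of_rows_list_def less_2_cases_iff)

text \<open>\<open>C_mat\<close> represents complex numbers by real matrices. What matters below is
  the consequence that matrices of this form commute.\<close>

lemma C_mat_mult: "C_mat l * C_mat m = C_mat (l * m)"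
proof (rule eq_matI)
  fix i j assume "i < dim_row (C_mat (l * m))" "j < dim_col (C_mat (l * m))"
  then have ij: "i < 2" "j < 2" using C_mat_carrier[of "l * m"] by (metis carrier_matD)+
  have "(C_mat l * C_mat m) $$ (i, j) = (\<Sum>k = 0..<2. C_mat l $$ (i, k) * C_mat m $$ (k, j))"
    using ij carrier_matD[OF C_mat_carrier] by (simp add: scalar_prod_def)
  also have "\<dots> = C_mat l $$ (i, 0) * C_mat m $$ (0, j) + C_mat l $$ (i, 1) * C_mat m $$ (1, j)"
    by (simp add: numeral_2_eq_2)
  also have "\<dots> = C_mat (l * m) $$ (i, j)"
    using ij by (auto simp: index_C_mat less_2_cases_iff algebra_simps)
  finally show "(C_mat l * C_mat m) $$ (i, j) = C_mat (l * m) $$ (i, j)" .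
qed (use carrier_matD[OF C_mat_carrier] in auto)

text \<open>The condition on row 0 says that the intertwiner can send the first basis row vector of \<open>M\<close> to any
  basis row vector of \<open>N\<close>.\<close>

definition intertwinable :: "real mat \<Rightarrow> real mat \<Rightarrow> bool" where
  "intertwinable M N \<longleftrightarrow> (\<forall>q < dim_row N. \<exists>W \<in> carrier_mat (dim_row M) (dim_row N).
     M * W = W * N \<and> (\<forall>c < dim_row N. W $$ (0, c) = (if c = q then 1 else 0)))"

lemma intertwinable_jordan_block:
  assumes "k \<le> m"
  shows "intertwinable (jordan_block m t) (jordan_block k t)"
  unfolding intertwinable_def
proof (intro allI impI)
  fix q assume q: "q < dim_row (jordan_block k t)"
  show "\<exists>W \<in> carrier_mat (dim_row (jordan_block m t)) (dim_row (jordan_block k t)).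
     jordan_block m t * W = W * jordan_block k t \<and>
     (\<forall>c < dim_row (jordan_block k t). W $$ (0, c) = (if c = q then 1 else 0))"
    using jordan_block_mult_shift[OF assms, of t q] q assms
    by (intro bexI[of _ "shift_mat m k q"]) (auto simp: shift_mat_def)
qed

lemma real_jordan_block_carrier [simp]: "real_jordan_block m l \<in> carrier_mat (2 * m) (2 * m)"
proof -
  have "1\<^sub>m m \<otimes>\<^sub>m C_mat l \<in> carrier_mat (m * 2) (m * 2)"
    "jordan_block m (0 :: real) \<otimes>\<^sub>m 1\<^sub>m 2 \<in> carrier_mat (m * 2) (m * 2)"
    by (auto intro!: kron_carrier)
  then show ?thesis unfolding real_jordan_block_def by (simp add: mult.commute)
qed

text \<open>A Kronecker product of a shift with some \<open>C_mat\<close> works factor by factor: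
  the shift intertwines the nilpotent parts, and \<open>C_mat l\<close> commutes with the second
  factor.\<close>

lemma intertwinable_real_jordan_block:
  assumes "k \<le> m"
  shows "intertwinable (real_jordan_block m l) (real_jordan_block k l)"
  unfolding intertwinable_def
proof (intro allI impI)
  fix q assume "q < dim_row (real_jordan_block k l)"
  then have q: "q < 2 * k" using real_jordan_block_carrier[of k l] by (metis carrier_matD(1))
  \<comment> \<open>The target column \<open>q\<close> is position \<open>q mod 2\<close> of the
    pair \<open>q div 2\<close>. The top rows of \<open>C_mat 1\<close> and
    \<open>C_mat \<i>\<close> are \<open>(1, 0)\<close> and \<open>(0, 1)\<close>, so the power of
    \<open>\<i>\<close> chooses the position.\<close>
  let ?S = "shift_mat m k (q div 2)" and ?R = "C_mat (\<i> ^ (q mod 2))"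
  define W where "W = ?S \<otimes>\<^sub>m ?R"
  have W: "W \<in> carrier_mat (m * 2) (k * 2)" by (simp add: W_def)
  have c: "1\<^sub>m p \<otimes>\<^sub>m C_mat l \<in> carrier_mat (p * 2) (p * 2)"
    "jordan_block p (0 :: real) \<otimes>\<^sub>m 1\<^sub>m 2 \<in> carrier_mat (p * 2) (p * 2)" for p
    by (auto intro!: kron_carrier)
  have "real_jordan_block m l * W = (1\<^sub>m m \<otimes>\<^sub>m C_mat l) * W + (jordan_block m 0 \<otimes>\<^sub>m 1\<^sub>m 2) * W"
    unfolding real_jordan_block_def using c W by (intro add_mult_distrib_mat)
  also have "\<dots> = (?S \<otimes>\<^sub>m (C_mat l * ?R)) + ((jordan_block m 0 * ?S) \<otimes>\<^sub>m ?R)"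
    unfolding W_def using kron_mult_kron[of "1\<^sub>m m" m m "C_mat l" 2 2 ?S k ?R 2]
      kron_mult_kron[of "jordan_block m 0" m m "1\<^sub>m 2" 2 2 ?S k ?R 2]
    by (simp add: left_mult_one_mat[OF shift_mat_carrier] left_mult_one_mat[OF C_mat_carrier])
  also have "\<dots> = (?S \<otimes>\<^sub>m (?R * C_mat l)) + ((?S * jordan_block k 0) \<otimes>\<^sub>m ?R)"
    by (simp add: C_mat_mult mult.commute jordan_block_mult_shift[OF assms])
  also have "\<dots> = W * (1\<^sub>m k \<otimes>\<^sub>m C_mat l) + W * (jordan_block k 0 \<otimes>\<^sub>m 1\<^sub>m 2)"
    unfolding W_def using kron_mult_kron[of ?S m k ?R 2 2 "1\<^sub>m k" k "C_mat l" 2]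
      kron_mult_kron[of ?S m k ?R 2 2 "jordan_block k 0" k "1\<^sub>m 2" 2]
    by (simp add: right_mult_one_mat[OF shift_mat_carrier] right_mult_one_mat[OF C_mat_carrier])
  also have "\<dots> = W * real_jordan_block k l"
    unfolding real_jordan_block_def using c W by (intro mult_add_distrib_mat[symmetric])
  finally have comm: "real_jordan_block m l * W = W * real_jordan_block k l" .
  have row: "W $$ (0, c) = (if c = q then 1 else 0)" if "c < 2 * k" for c
  proof -
    have "c div 2 < k" "0 < m" using that assms by auto
    moreover have "c = q \<longleftrightarrow> c div 2 = q div 2 \<and> c mod 2 = q mod 2"
      using div_mult_mod_eq[of c 2] div_mult_mod_eq[of q 2] by metis
    ultimately show ?thesis using that
      using carrier_matD[OF C_mat_carrier] even_iff_mod_2_eq_zero[of q]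
      by (auto simp: W_def kron_def shift_mat_def index_C_mat)
  qed
  show "\<exists>W \<in> carrier_mat (dim_row (real_jordan_block m l)) (dim_row (real_jordan_block k l)).
     real_jordan_block m l * W = W * real_jordan_block k l \<and>
     (\<forall>c < dim_row (real_jordan_block k l). W $$ (0, c) = (if c = q then 1 else 0))"
    using W comm row carrier_matD(1)[OF real_jordan_block_carrier]
    by (intro bexI[of _ W]) (auto simp: mult.commute)
qed

section \<open>Index lists and commuting matrices of block diagonal matrices\<close>

definition first_columns :: "nat list \<Rightarrow> nat \<Rightarrow> (nat \<times> nat) list" where
  "first_columns ds a = map (\<lambda>k. (sum_list (take a ds) + k, sum_list (take a ds))) [0..<ds ! a]"

lemma in_set_first_columns:
  "(i, p) \<in> set (first_columns ds a) \<longleftrightarrow> (\<exists>k < ds ! a. i = sum_list (take a ds) + k \<and> p = sum_list (take a ds))"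
  by (auto simp: first_columns_def)

text \<open>Different blocks occupy disjoint index ranges, by uniqueness of block
  coordinates.\<close>

lemma distinct_first_columns:
  assumes "distinct as" "set as \<subseteq> {..<length ds}"
  shows "distinct (map fst (concat (map (first_columns ds) as)))"
  using assms
proof (induction as)
  case (Cons a as)
  have "fst ` set (first_columns ds a) \<inter> fst ` set (concat (map (first_columns ds) as)) = {}"
  proof (rule ccontr)
    assume "\<not> ?thesis"
    then obtain b k l where *: "b \<in> set as" "k < ds ! a" "l < ds ! b"
      "sum_list (take a ds) + k = sum_list (take b ds) + l"
      by (auto simp: first_columns_def)
    have "(a, k) = (b, l)"
      using locate_offset[of a ds k] locate_offset[of b ds l] * Cons.prems by auto
    then show False using * Cons.prems by auto
  qed
  moreover have "distinct (map fst (first_columns ds a))"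
    by (simp add: first_columns_def comp_def distinct_map inj_on_def)
  ultimately show ?case using Cons by simp
qed simp

text \<open>\<open>X\<close> is \<open>W\<close> placed at block position \<open>(a, b)\<close> and
  extended by zero. Both products are supported on that block, where they are
  \<open>Bs ! a * W\<close> and \<open>W * Bs ! b\<close>.\<close>

lemma diag_block_mat_commute:
  fixes Bs :: "real mat list"
  assumes sq: "\<forall>M \<in> set Bs. square_mat M"
    and ab: "a < length Bs" "b < length Bs"
    and W: "W \<in> carrier_mat (dim_row (Bs ! a)) (dim_row (Bs ! b))" "Bs ! a * W = W * Bs ! b"
  defines "ds \<equiv> map dim_row Bs"
  defines "X \<equiv> mat (sum_list ds) (sum_list ds) (\<lambda>(r, c). case (locate ds r, locate ds c) of
    ((a', k), (b', l)) \<Rightarrow> if a' = a \<and> b' = b then W $$ (k, l) else 0)"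
  shows "diag_block_mat Bs * X = X * diag_block_mat Bs"
proof (rule eq_matI)
  let ?J = "diag_block_mat Bs" and ?n = "sum_list ds"
  have J: "?J \<in> carrier_mat ?n ?n"
    using diag_block_mat_square[of Bs] sq by (auto simp: dim_diag_block_mat ds_def)
  have X: "X \<in> carrier_mat ?n ?n" by (simp add: X_def)
  have len: "length ds = length Bs" by (simp add: ds_def)
  have d: "dim_row (Bs ! x) = ds ! x" "dim_col (Bs ! x) = ds ! x" if "x < length Bs" for x
    using that sq by (auto simp: ds_def)
  fix r c assume "r < dim_row (X * ?J)" "c < dim_col (X * ?J)"
  then have rc: "r < ?n" "c < ?n" using J X by auto
  obtain x i where r: "locate ds r = (x, i)" by (cases "locate ds r")
  obtain y l where c: "locate ds c = (y, l)" by (cases "locate ds c")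
  note R = locate_less[OF rc(1) r, unfolded len] and C = locate_less[OF rc(2) c, unfolded len]
  have Jr: "?J $$ (r, sum_list (take z ds) + k) = (if x = z then Bs ! x $$ (i, k) else 0)"
    "?J $$ (sum_list (take z ds) + k, c) = (if z = y then Bs ! z $$ (k, l) else 0)"
    "X $$ (r, sum_list (take z ds) + k) = (if x = a \<and> z = b then W $$ (i, k) else 0)"
    "X $$ (sum_list (take z ds) + k, c) = (if z = a \<and> y = b then W $$ (k, l) else 0)"
    if "z < length Bs" "k < ds ! z" for z k
    using index_diag_block_mat[OF sq, folded ds_def, OF rc(1) offset_less r locate_offset]
      index_diag_block_mat[OF sq, folded ds_def, OF offset_less rc(2) locate_offset c]
      rc r c locate_offset[of z ds k] offset_less[of z ds k] that
    by (auto simp: X_def len)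
  have "(?J * X) $$ (r, c) = (\<Sum>s = 0..<?n. ?J $$ (r, s) * X $$ (s, c))"
    using rc J X by (simp add: scalar_prod_def)
  also have "\<dots> = (\<Sum>z = 0..<length Bs. \<Sum>k = 0..<ds ! z.
      ?J $$ (r, sum_list (take z ds) + k) * X $$ (sum_list (take z ds) + k, c))"
    by (simp add: sum_locate len)
  also have "\<dots> = (\<Sum>z = 0..<length Bs. if z = x then if x = a \<and> y = b
      then \<Sum>k = 0..<ds ! x. Bs ! x $$ (i, k) * W $$ (k, l) else 0 else 0)"
    by (intro sum.cong refl) (auto simp: Jr)
  also have "\<dots> = (if x = a \<and> y = b then (Bs ! a * W) $$ (i, l) else 0)"
    using R C W(1) ab by (auto simp: scalar_prod_def d)
  also have "\<dots> = (if x = a \<and> y = b then (W * Bs ! b) $$ (i, l) else 0)" by (simp add: W(2))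
  also have "\<dots> = (\<Sum>z = 0..<length Bs. if z = y then if x = a \<and> y = b
      then \<Sum>k = 0..<ds ! y. W $$ (i, k) * Bs ! y $$ (k, l) else 0 else 0)"
    using R C W(1) ab by (auto simp: scalar_prod_def d)
  also have "\<dots> = (\<Sum>z = 0..<length Bs. \<Sum>k = 0..<ds ! z.
      X $$ (r, sum_list (take z ds) + k) * ?J $$ (sum_list (take z ds) + k, c))"
    by (intro sum.cong refl) (auto simp: Jr)
  also have "\<dots> = (\<Sum>s = 0..<?n. X $$ (r, s) * ?J $$ (s, c))"
    by (simp add: sum_locate len)
  also have "\<dots> = (X * ?J) $$ (r, c)"
    using rc J X by (simp add: scalar_prod_def)
  finally show "(?J * X) $$ (r, c) = (X * ?J) $$ (r, c)" .
qed (use diag_block_mat_square[of Bs] sq in \<open>auto simp: X_def dim_diag_block_mat ds_def\<close>)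

text \<open>An instance of \<open>hill_pick_criterion\<close> with \<open>blk\<close> the number of
  the diagonal block. The intertwiners supply cyclicity, as each block admits one from a block
  listed in \<open>as\<close>.\<close>

lemma (in lyapunov_pair) block_hill_pick_criterion:
  fixes Bs :: "real mat list" and as :: "nat list"
  assumes Jb: "J = diag_block_mat Bs" and sq: "\<forall>M \<in> set Bs. square_mat M"
    and bicomm: "\<And>X. X \<in> carrier_mat n n \<Longrightarrow> J * X = X * J \<Longrightarrow> B * X = X * B"
    and as: "distinct as" "set as \<subseteq> {..<length Bs}"
    and pos: "\<And>a. a \<in> set as \<Longrightarrow> 0 < dim_row (Bs ! a)"
    and inter: "\<And>b. b < length Bs \<Longrightarrow> \<exists>a \<in> set as. intertwinable (Bs ! a) (Bs ! b)"
  defines "us \<equiv> concat (map (first_columns (map dim_row Bs)) as)"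
  defines "H \<equiv> hill_pick_sub n (lyapunov_L J B) us us"
  shows "transpose_mat H = H" "lyapunov_dominates B J \<longleftrightarrow> psd_mat H"
proof -
  define ds where "ds = map dim_row Bs"
  let ?off = "\<lambda>a. sum_list (take a ds)" and ?blk = "\<lambda>r. fst (locate ds r)"
  have n: "n = sum_list ds" using J by (auto simp: Jb dim_diag_block_mat ds_def)
  have len: "length ds = length Bs" by (simp add: ds_def)
  have us: "(i, p) \<in> set us \<longleftrightarrow> (\<exists>a \<in> set as. \<exists>k < ds ! a. i = ?off a + k \<and> p = ?off a)" for i p
    unfolding us_def ds_def by (simp add: in_set_first_columns)
  have a: "a < length ds" "0 < ds ! a" "locate ds (?off a) = (a, 0)" "?off a < n" if "a \<in> set as" for a
  proof -
    show "a < length ds" "0 < ds ! a" using that as pos[OF that] by (auto simp: ds_def)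
    then show "locate ds (?off a) = (a, 0)" "?off a < n"
      using locate_offset[of a ds 0] offset_less[of a ds 0] n by auto
  qed
  have U: "snd ` set us = ?off ` set as"
  proof (intro Set.set_eqI iffI)
    fix p assume "p \<in> snd ` set us"
    then obtain i where "(i, p) \<in> set us" by auto
    then show "p \<in> ?off ` set as" unfolding us by auto
  next
    fix p assume "p \<in> ?off ` set as"
    then obtain x where x: "x \<in> set as" "p = ?off x" by auto
    then have "(p, p) \<in> set us" unfolding us using a(2)[OF x(1)] by (intro bexI[of _ x] exI[of _ 0]) auto
    then show "p \<in> snd ` set us" by force
  qed
  have blk: "J $$ (r, c) = 0" if "r < n" "c < n" "?blk r \<noteq> ?blk c" for r c
  proof -
    obtain x k y l where "locate ds r = (x, k)" "locate ds c = (y, l)"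
      by (cases "locate ds r", cases "locate ds c") auto
    then show ?thesis
      using that index_diag_block_mat[OF sq, folded ds_def Jb, of r c x k y l] by (simp add: n)
  qed
  have less: "i < n \<and> p < n \<and> ?blk i = ?blk p" if ip: "(i, p) \<in> set us" for i p
  proof -
    obtain a k where *: "a \<in> set as" "k < ds ! a" "i = ?off a + k" "p = ?off a"
      using ip us by auto
    then show ?thesis using a[OF *(1)] locate_offset[of a ds k] offset_less[of a ds k] n by auto
  qed
  have full: "(r, p) \<in> set us" if ip: "(i, p) \<in> set us" and r: "r < n" "?blk r = ?blk p" for i p r
  proof -
    obtain a k where *: "a \<in> set as" "p = ?off a" using ip us by auto
    then obtain k where "locate ds r = (a, k)" using r a[OF *(1)] by (metis fst_conv prod.collapse)
    from locate_less[OF _ this] r n * us show ?thesis by auto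
  qed
  have unique: "p = q" if "(i, p) \<in> set us" "(j, q) \<in> set us" "?blk p = ?blk q" for i p j q
    using that us a by auto
  have dist: "distinct (map fst us)"
    unfolding us_def using as by (intro distinct_first_columns) auto
  have cyc: "\<exists>X \<in> carrier_mat n n. \<exists>q \<in> snd ` set us. J * X = X * J \<and>
      (\<forall>r \<in> snd ` set us. \<forall>c < n. X $$ (r, c) = (if r = q \<and> c = p then 1 else 0))"
    if p: "p < n" for p
  proof -
    obtain b m where b: "locate ds p = (b, m)" by (cases "locate ds p")
    note P = locate_less[OF p[unfolded n] b]
    then obtain a' where a': "a' \<in> set as" "intertwinable (Bs ! a') (Bs ! b)" using inter[of b] len by auto
    have "m < dim_row (Bs ! b)" using P by (auto simp: ds_def)
    then obtain W where W: "W \<in> carrier_mat (dim_row (Bs ! a')) (dim_row (Bs ! b))"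
      "Bs ! a' * W = W * Bs ! b" "\<And>c. c < dim_row (Bs ! b) \<Longrightarrow> W $$ (0, c) = (if c = m then 1 else 0)"
      using a'(2) unfolding intertwinable_def by blast
    \<comment> \<open>Among the rows at first indices of listed blocks, only that of
      \<open>a'\<close> is non-zero in \<open>X\<close>: it is row 0 of \<open>W\<close>, hence the
      unit row at \<open>p\<close>.\<close>
    define X where "X = mat (sum_list ds) (sum_list ds) (\<lambda>(r, c). case (locate ds r, locate ds c) of
      ((x, k), (y, l)) \<Rightarrow> if x = a' \<and> y = b then W $$ (k, l) else 0)"
    have X: "X \<in> carrier_mat n n" by (simp add: X_def n)
    have comm: "J * X = X * J"
      unfolding Jb X_def ds_def using a'(1) as P len by (intro diag_block_mat_commute[OF sq _ _ W(1,2)]) auto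
    have row: "X $$ (r, c) = (if r = ?off a' \<and> c = p then 1 else 0)" if r: "r \<in> snd ` set us" and c: "c < n" for r c
    proof -
      obtain x where x: "x \<in> set as" "r = ?off x" using r U by auto
      obtain y l where y: "locate ds c = (y, l)" by (cases "locate ds c")
      note C = locate_less[OF c[unfolded n] y]
      have "X $$ (r, c) = (if x = a' \<and> y = b then W $$ (0, l) else 0)"
        using x y c a[OF x(1)] by (simp add: X_def n)
      moreover have "W $$ (0, l) = (if l = m then 1 else 0)" if "y = b"
        using W(3)[of l] that C by (auto simp: ds_def)
      moreover have "x = a' \<longleftrightarrow> r = ?off a'" 
        using a(3)[OF x(1)] a(3)[OF a'(1)] x(2) by (metis fst_conv)
      moreover have "y = b \<and> l = m \<longleftrightarrow> c = p"
        using conjunct2[OF conjunct2[OF C]] conjunct2[OF conjunct2[OF P]] y b by (metis Pair_inject)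
      ultimately show ?thesis by auto
    qed
    show ?thesis
      using comm row U a'(1) by (intro bexI[OF _ X] bexI[of _ "?off a'"] conjI ballI allI impI) auto
  qed
  note crit = hill_pick_criterion[where us = us and blk = ?blk]
  show "transpose_mat H = H"
    unfolding H_def by (rule crit(1)) (fact bicomm blk less full unique dist cyc)+
  show "lyapunov_dominates B J \<longleftrightarrow> psd_mat H"
    unfolding H_def by (rule crit(2)) (fact bicomm blk less full unique dist cyc)+
qed

text \<open>A test matrix \<open>H\<close> for \<open>J\<close> becomes \<open>G = Q^T H Q\<close>
  for \<open>A\<close>, and congruence by \<open>P\<close> leads back; congruences preserve
  semidefiniteness. Used in both directions, it makes domination invariant under similarity.\<close>

lemma lyapunov_dominates_similar:
  assumes c: "A \<in> carrier_mat n n" "J \<in> carrier_mat n n" "B \<in> carrier_mat n n" "C \<in> carrier_mat n n"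
    "P \<in> carrier_mat n n" "Q \<in> carrier_mat n n"
    and PQ: "Q * P = 1\<^sub>m n" and AP: "A * P = P * J" "J * Q = Q * A" and BP: "B * P = P * C"
    and dom: "lyapunov_dominates B A"
  shows "lyapunov_dominates C J"
  unfolding lyapunov_dominates_def lyapunov_op_def[symmetric]
proof (intro ballI impI)
  fix H assume "H \<in> carrier_mat (dim_row J) (dim_row J)" "symmetric_mat H" and psd: "psd_mat (lyapunov_op J H)"
  then have H: "H \<in> carrier_mat n n" and sym: "transpose_mat H = H" using c by (auto simp: symmetric_mat_def)
  define G where "G = transpose_mat Q * H * Q"
  have G: "G \<in> carrier_mat n n" using c H by (simp add: G_def)
  have "transpose_mat G = G"
    unfolding G_def using transpose_mult3[of "transpose_mat Q" n n H n Q n] c H sym by simp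
  moreover have "psd_mat (lyapunov_op A G)"
    unfolding G_def using lyapunov_op_intertwine[OF c(2,1,6,6) H AP(2) AP(2)]
      psd_mat_congruence[OF lyapunov_op_carrier[OF c(2) H] c(6) psd] by simp
  ultimately have "psd_mat (lyapunov_op B G)"
    using dom G c by (auto simp: lyapunov_dominates_def lyapunov_op_def[symmetric] symmetric_mat_def)
  then have "psd_mat (transpose_mat P * lyapunov_op B G * P)"
    using c G by (intro psd_mat_congruence) auto
  also have "transpose_mat P * lyapunov_op B G * P = lyapunov_op C (transpose_mat P * G * P)"
    by (rule lyapunov_op_intertwine[OF c(3,4,5,5) G BP BP])
  also have "transpose_mat P * G * P = transpose_mat (Q * P) * H * (Q * P)"
    unfolding G_def using c H
    by (simp add: transpose_mult[where nr=n and n=n and nc=n] assoc_mult_mat[where n\<^sub>1=n and n\<^sub>2=n and n\<^sub>3=n and n\<^sub>4=n])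
  also have "\<dots> = H" unfolding PQ using H by simp
  finally show "psd_mat (lyapunov_op C H)" .
qed

section \<open>Block partitions of the Hill-Pick matrix\<close>

lemma hill_pick_sub_concat:
  "hill_pick_sub n L (concat xss) (concat yss) =
    block_mat (map length xss) (map length yss) (\<lambda>i j. hill_pick_sub n L (xss ! i) (yss ! j))"
proof (rule eq_matI)
  fix k l assume "k < dim_row (block_mat (map length xss) (map length yss) (\<lambda>i j. hill_pick_sub n L (xss ! i) (yss ! j)))"
    "l < dim_col (block_mat (map length xss) (map length yss) (\<lambda>i j. hill_pick_sub n L (xss ! i) (yss ! j)))"
  then have kl: "k < length (concat xss)" "l < length (concat yss)"
    by (auto simp: block_mat_def length_concat)
  obtain a i where a: "locate (map length xss) k = (a, i)" by (cases "locate (map length xss) k")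
  obtain b j where b: "locate (map length yss) l = (b, j)" by (cases "locate (map length yss) l")
  show "hill_pick_sub n L (concat xss) (concat yss) $$ (k, l) =
    block_mat (map length xss) (map length yss) (\<lambda>i j. hill_pick_sub n L (xss ! i) (yss ! j)) $$ (k, l)"
    using concat_nth_locate[OF kl(1) a] concat_nth_locate[OF kl(2) b] kl a b
    by (simp add: block_mat_def hill_pick_sub_def length_concat)
qed (auto simp: block_mat_def hill_pick_sub_def length_concat)

text \<open>Symmetry of the whole matrix identifies its lower left part with the transpose of the
  upper right one.\<close>

lemma hill_pick_sub_append:
  assumes "transpose_mat (hill_pick_sub n L (us @ vs) (us @ vs)) = hill_pick_sub n L (us @ vs) (us @ vs)"
  shows "hill_pick_sub n L (us @ vs) (us @ vs) = four_block_mat (hill_pick_sub n L us us)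
    (hill_pick_sub n L us vs) (transpose_mat (hill_pick_sub n L us vs)) (hill_pick_sub n L vs vs)"
    (is "?H = ?R")
proof (rule eq_matI)
  have H: "?H \<in> carrier_mat (length us + length vs) (length us + length vs)"
    by (simp add: hill_pick_sub_def)
  fix k l assume "k < dim_row ?R" "l < dim_col ?R"
  then have kl: "k < length us + length vs" "l < length us + length vs" by (auto simp: hill_pick_sub_def)
  have sym: "?H $$ (k, l) = ?H $$ (l, k)"
    using assms kl H by (metis carrier_matD index_transpose_mat(1))
  show "?H $$ (k, l) = ?R $$ (k, l)"
  proof (cases "l < length us \<and> \<not> k < length us")
    case True
    moreover have "k - length us < length vs" using True kl by auto
    ultimately show ?thesis unfolding sym using kl by (simp add: hill_pick_sub_def nth_append)
  next
    case False
    then show ?thesis using kl by (auto simp: hill_pick_sub_def nth_append)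
  qed
qed (auto simp: hill_pick_sub_def)

subsection \<open>The blocks of the real Jordan form\<close>

text \<open>Grouping by eigenvalue retains what the flat list of blocks forgets: with non-increasing
  sizes, the head of each group is the largest block of its eigenvalue.\<close>

definition jordan_groups :: "(complex \<times> nat list) list \<Rightarrow> (real \<times> nat list) list \<Rightarrow> real mat list list" where
  "jordan_groups Cs Rs = map (\<lambda>(l, ms). map (\<lambda>m. real_jordan_block m l) ms) Cs @
     map (\<lambda>(t, ns). map (\<lambda>k. jordan_block k t) ns) Rs"

lemma real_jordan_matrix_eq: "real_jordan_matrix Cs Rs = diag_block_mat (concat (jordan_groups Cs Rs))"
  by (simp add: real_jordan_matrix_def jordan_groups_def)

lemma dim_real_jordan_block [simp]:
  "dim_row (real_jordan_block m l) = 2 * m" "dim_col (real_jordan_block m l) = 2 * m"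
  using carrier_matD[OF real_jordan_block_carrier] by blast+

lemma sum_list_dim_real_jordan_blocks:
  "sum_list (map (dim_row \<circ> (\<lambda>m. real_jordan_block m l)) ms) = 2 * sum_list ms"
  by (induction ms) auto

lemma sum_list_dim_jordan_blocks:
  "sum_list (map (dim_row \<circ> (\<lambda>k. jordan_block k t)) ns) = sum_list ns"
  by (induction ns) auto

lemma complex_offset_eq:
  assumes "s \<le> length Cs"
  shows "complex_offset Cs s = sum_list (map dim_row (concat (take s (jordan_groups Cs Rs))))"
  using assms
proof (induction s)
  case (Suc s)
  obtain l ms where "Cs ! s = (l, ms)" by (cases "Cs ! s")
  then show ?case using Suc
    by (simp add: complex_offset_def take_Suc_conv_app_nth jordan_groups_def nth_append
        sum_list_dim_real_jordan_blocks del: take_append)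
qed (simp add: complex_offset_def)

lemma real_offset_eq:
  assumes "j \<le> length Rs"
  shows "real_offset Cs Rs j = sum_list (map dim_row (concat (take (length Cs + j) (jordan_groups Cs Rs))))"
  using assms
proof (induction j)
  case 0
  then show ?case using complex_offset_eq[of "length Cs" Cs Rs] by (simp add: real_offset_def)
next
  case (Suc j)
  obtain t ns where "Rs ! j = (t, ns)" by (cases "Rs ! j")
  then show ?case using Suc
    by (simp add: real_offset_def take_Suc_conv_app_nth jordan_groups_def nth_append
        sum_list_dim_jordan_blocks del: take_append)
qed

text \<open>The position in \<open>concat Gs\<close> of the first block of each group, that is, of the largest block
  of each eigenvalue.\<close>

definition group_heads :: "'a list list \<Rightarrow> nat list" where
  "group_heads Gs = map (\<lambda>g. length (concat (take g Gs))) [0..<length Gs]"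

text \<open>The head of group \<open>g\<close> has coordinates \<open>(g, 0)\<close> in the
  concatenated list, a valid position since groups are non-empty. Uniqueness of coordinates gives
  distinctness.\<close>

lemma group_heads:
  assumes ne: "\<forall>G \<in> set Gs. G \<noteq> []"
  shows "distinct (group_heads Gs)" "set (group_heads Gs) \<subseteq> {..<length (concat Gs)}"
    and "g < length Gs \<Longrightarrow> concat Gs ! (length (concat (take g Gs))) = hd (Gs ! g)"
proof -
  \<comment> \<open>The summand 0 is the inner coordinate, in the form that
    \<open>locate_offset\<close> expects.\<close>
  have e: "length (concat (take g Gs)) = sum_list (take g (map length Gs)) + 0" for g
    by (simp add: length_concat take_map)
  have pos: "0 < map length Gs ! g" if "g < length Gs" for g
    using ne that by auto
  have loc: "locate (map length Gs) (length (concat (take g Gs))) = (g, 0)" if "g < length Gs" for g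
    unfolding e using that pos[OF that] by (intro locate_offset) auto
  have less: "length (concat (take g Gs)) < length (concat Gs)" if "g < length Gs" for g
    using offset_less[of g "map length Gs" 0] pos[OF that] that by (simp add: length_concat take_map)
  have "inj_on (\<lambda>g. length (concat (take g Gs))) {0..<length Gs}"
    using loc by (intro inj_onI) (metis atLeastLessThan_iff fst_conv)
  then show "distinct (group_heads Gs)" by (simp add: group_heads_def distinct_map)
  show "set (group_heads Gs) \<subseteq> {..<length (concat Gs)}" using less by (auto simp: group_heads_def)
  show "concat Gs ! (length (concat (take g Gs))) = hd (Gs ! g)" if "g < length Gs"
    using concat_nth_locate[OF less[OF that] loc[OF that]] ne that by (simp add: hd_conv_nth)
qed

lemma first_columns_group_head:
  assumes ne: "\<forall>G \<in> set Gs. G \<noteq> []" and g: "g < length Gs"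
    and o: "p = sum_list (map dim_row (concat (take g Gs)))"
  shows "first_columns (map dim_row (concat Gs)) (length (concat (take g Gs))) =
    map (\<lambda>k. (p + k, p)) [0..<dim_row (hd (Gs ! g))]"
proof -
  have "concat Gs = concat (take g Gs) @ concat (drop g Gs)"
    by (metis append_take_drop_id concat_append)
  then have "take (length (concat (take g Gs))) (concat Gs) = concat (take g Gs)"
    by (metis append_eq_conv_conj)
  then have "sum_list (take (length (concat (take g Gs))) (map dim_row (concat Gs))) = p"
    unfolding o by (simp only: take_map)
  moreover have "length (concat (take g Gs)) < length (concat Gs)"
    using group_heads(2)[OF ne] g by (auto simp: group_heads_def image_subset_iff)
  ultimately show ?thesis
    using group_heads(3)[OF ne g] by (simp add: first_columns_def)
qed

text \<open>Non-increasing sizes make the head of a group at least as large as every member, which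
  is the condition for blocks with a common eigenvalue to be intertwinable.\<close>

lemma jordan_groups_block_sizes:
  assumes "\<forall>ms \<in> set (map snd Cs). block_sizes ms" "\<forall>ns \<in> set (map snd Rs). block_sizes ns"
    and G: "G \<in> set (jordan_groups Cs Rs)"
  shows "G \<noteq> []" "0 < dim_row (hd G)" "M \<in> set G \<Longrightarrow> square_mat M" "M \<in> set G \<Longrightarrow> intertwinable (hd G) M"
proof -
  have hd_ge: "m \<le> hd ms" if "block_sizes ms" "m \<in> set ms" for m ms
    using that by (cases ms) (auto simp: block_sizes_def)
  have hd_pos: "0 < hd ms" "ms \<noteq> []" if "block_sizes ms" for ms
    using that by (cases ms; auto simp: block_sizes_def)+
  consider l ms where "G = map (\<lambda>m. real_jordan_block m l) ms" "block_sizes ms"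
    | t ns where "G = map (\<lambda>k. jordan_block k t) ns" "block_sizes ns"
    using G assms(1,2) by (force simp: jordan_groups_def)
  then have "G \<noteq> [] \<and> 0 < dim_row (hd G) \<and> (\<forall>M \<in> set G. square_mat M \<and> intertwinable (hd G) M)"
  proof cases
    case 1
    then show ?thesis using hd_ge[of ms] hd_pos[of ms]
      by (auto simp: hd_map intertwinable_real_jordan_block)
  next
    case 2
    then show ?thesis using hd_ge[of ns] hd_pos[of ns]
      by (auto simp: hd_map intertwinable_jordan_block)
  qed
  then show "G \<noteq> []" "0 < dim_row (hd G)" "M \<in> set G \<Longrightarrow> square_mat M" "M \<in> set G \<Longrightarrow> intertwinable (hd G) M"
    by auto
qed

text \<open>Translates offsets computed from the eigenvalue data into positions in the flat list of
  blocks. The real groups come after the complex ones, hence the shift by \<open>?c\<close>.\<close>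

lemma Upsilon_eq_first_columns:
  assumes "\<forall>ms \<in> set (map snd Cs). block_sizes ms" "\<forall>ns \<in> set (map snd Rs). block_sizes ns"
  shows "Upsilon Cs Rs = concat (map (first_columns (map dim_row (concat (jordan_groups Cs Rs))))
    (group_heads (jordan_groups Cs Rs)))"
proof -
  let ?G = "jordan_groups Cs Rs" and ?c = "length Cs"
  have ne: "\<forall>G \<in> set ?G. G \<noteq> []" using jordan_groups_block_sizes(1)[OF assms] by blast
  have len: "length ?G = ?c + length Rs" by (simp add: jordan_groups_def)
  let ?f = "\<lambda>g. first_columns (map dim_row (concat ?G)) (length (concat (take g ?G)))"
  have 1: "Upsilon1 Cs s = ?f s" if "s < ?c" for s
  proof -
    obtain l ms where ms: "Cs ! s = (l, ms)" by (cases "Cs ! s")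
    then have "block_sizes ms" using assms(1) that by (metis length_map nth_map nth_mem snd_conv)
    then show ?thesis
      using first_columns_group_head[OF ne _ complex_offset_eq[of s Cs Rs]] that ms
      by (auto simp: Upsilon1_def len jordan_groups_def nth_append hd_map block_sizes_def)
  qed
  have 2: "Upsilon2 Cs Rs j = ?f (?c + j)" if "j < length Rs" for j
  proof -
    obtain t ns where ns: "Rs ! j = (t, ns)" by (cases "Rs ! j")
    then have "block_sizes ns" using assms(2) that by (metis length_map nth_map nth_mem snd_conv)
    then show ?thesis
      using first_columns_group_head[OF ne _ real_offset_eq[of j Rs Cs]] that ns
      by (auto simp: Upsilon2_def len jordan_groups_def nth_append hd_map block_sizes_def)
  qed
  have "[0..<length ?G] = [0..<?c] @ map (\<lambda>j. ?c + j) [0..<length Rs]"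
    unfolding len by (intro nth_equalityI) (auto simp: nth_append)
  then have "concat (map ?f [0..<length ?G]) =
      concat (map ?f [0..<?c]) @ concat (map (\<lambda>j. ?f (?c + j)) [0..<length Rs])"
    by (simp add: comp_def)
  also have "\<dots> = Upsilon Cs Rs"
    unfolding Upsilon_def using 1 2 by (intro arg_cong2[of _ _ _ _ append] arg_cong[of _ _ concat]) auto
  finally show ?thesis by (simp add: group_heads_def comp_def)
qed

section \<open>Block form and domination criterion for the real Hill-Pick matrix\<close>

theorem theorem5p6:
  fixes n :: nat and A B P :: "real mat"
    and Cs :: "(complex \<times> nat list) list" and Rs :: "(real \<times> nat list) list"
  assumes "A \<in> carrier_mat n n" and "B \<in> carrier_mat n n"
    and "lyapunov_regular A"
    and "B \<in> bicommutant A"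
    and "real_jordan_form A P Cs Rs"
  shows "let H = real_hill_pick B P Cs Rs;
             sub = hill_pick_sub n (hill_pick_L B P Cs Rs);
             H1 = (\<lambda>i j. sub (Upsilon1 Cs i) (Upsilon1 Cs j));
             H2 = (\<lambda>i j. sub (Upsilon1 Cs i) (Upsilon2 Cs Rs j));
             H3 = (\<lambda>i j. sub (Upsilon2 Cs Rs i) (Upsilon2 Cs Rs j));
             ms = complex_sizes Cs;
             ns = real_sizes Rs;
             w = sum_list ms + sum_list ns
         in H \<in> carrier_mat w w \<and>
            H = four_block_mat (block_mat ms ms H1) (block_mat ms ns H2)
                               (transpose_mat (block_mat ms ns H2)) (block_mat ns ns H3) \<and>
            (\<forall>i < length Cs. \<forall>j < length Cs. H1 i j \<in> carrier_mat (ms ! i) (ms ! j)) \<and>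
            (\<forall>i < length Cs. \<forall>j < length Rs. H2 i j \<in> carrier_mat (ms ! i) (ns ! j)) \<and>
            (\<forall>i < length Rs. \<forall>j < length Rs. H3 i j \<in> carrier_mat (ns ! i) (ns ! j)) \<and>
            (lyapunov_dominates B A \<longleftrightarrow> psd_mat H)"
proof -
  note A = assms(1) and B = assms(2)
  define J where "J = real_jordan_matrix Cs Rs"
  define Q where "Q = mat_inv P"
  define C where "C = Q * B * P"
  define L where "L = hill_pick_L B P Cs Rs"
  have P: "P \<in> carrier_mat n n" "invertible_mat P" and J: "J \<in> carrier_mat n n" and AJ: "A = P * J * Q"
    and sizes: "\<forall>ms \<in> set (map snd Cs). block_sizes ms" "\<forall>ns \<in> set (map snd Rs). block_sizes ns"
    using assms(5) A unfolding real_jordan_form_def Let_def J_def Q_def by auto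
  have Q: "Q \<in> carrier_mat n n" and PQ: "P * Q = 1\<^sub>m n" "Q * P = 1\<^sub>m n"
    unfolding Q_def using mat_inv_eq[OF P(1) invertible_mat_det[OF P]] by auto
  have C: "C \<in> carrier_mat n n" using Q B P by (simp add: C_def)
  note a = assoc_mult_mat[where n\<^sub>1=n and n\<^sub>2=n and n\<^sub>3=n and n\<^sub>4=n]
  have PQl: "P * (Q * X) = X" "Q * (P * X) = X" if "X \<in> carrier_mat n n" for X
    using that PQ P Q by (simp_all flip: a)
  have AP: "A * P = P * J" and JQ: "J * Q = Q * A" and BP: "B * P = P * C" and CQ: "C * Q = Q * B"
    using A B C J P Q PQ by (simp_all add: AJ C_def a PQl)
  have L: "L = lyapunov_L J C"
    by (simp add: L_def hill_pick_L_def J_def C_def Q_def)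

  \<comment> \<open>Regularity gives injectivity for \<open>A\<close>; the similarity moves it to
    \<open>J\<close>.\<close>
  interpret pair: lyapunov_pair n J C
  proof
    fix H assume "H \<in> carrier_mat n n" "lyapunov_op J H = 0\<^sub>m n n"
    then show "H = 0\<^sub>m n n"
      using lyapunov_op_inj_of_inverse[OF J A Q P(1) PQ(2) JQ] lyapunov_op_inj[OF A assms(3)] by blast
  qed (fact J C)+

  \<comment> \<open>Conjugation takes \<open>X\<close> to \<open>P X Q\<close>, which commutes with
    \<open>A\<close> and therefore with \<open>B\<close>; conjugating back gives the claim for
    \<open>C\<close>.\<close>
  have bicomm: "C * X = X * C" if X: "X \<in> carrier_mat n n" "J * X = X * J" for X
  proof -
    let ?Y = "P * X * Q"
    have "?Y * A = P * (X * J) * Q" using X(1) A J P Q by (simp add: a flip: JQ)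
    also have "\<dots> = A * ?Y"
      unfolding X(2)[symmetric] using X(1) A J P Q by (simp add: AJ a PQl)
    finally have "?Y \<in> commutant n {A}" using X P Q by (simp add: commutant_def)
    then have "B * ?Y = ?Y * B" using assms(4) A by (simp add: bicommutant_def commutant_def)
    then have "Q * (B * ?Y) * P = Q * (?Y * B) * P" by simp
    then show ?thesis using X(1) B P Q PQ by (simp add: C_def a PQl)
  qed

  let ?G = "jordan_groups Cs Rs" and ?U = "Upsilon Cs Rs"
  note G = jordan_groups_block_sizes[OF sizes]
  have ne: "\<forall>G \<in> set ?G. G \<noteq> []" using G(1) by blast
  \<comment> \<open>The block \<open>b\<close> belongs to some group, and the head of that group has
    an intertwiner with it.\<close>
  have inter: "\<exists>a \<in> set (group_heads ?G). intertwinable (concat ?G ! a) (concat ?G ! b)"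
    if b: "b < length (concat ?G)" for b
  proof -
    obtain g k where "locate (map length ?G) b = (g, k)" by (cases "locate (map length ?G) b")
    from concat_nth_locate[OF b this]
    have "g < length ?G" "concat ?G ! b \<in> set (?G ! g)" by auto
    then show ?thesis
      using G(4)[of "?G ! g" "concat ?G ! b"] group_heads(3)[OF ne, of g]
      by (intro bexI[of _ "length (concat (take g ?G))"]) (auto simp: group_heads_def)
  qed
  have pos: "0 < dim_row (concat ?G ! a)" if "a \<in> set (group_heads ?G)" for a
    using that G(2) group_heads(3)[OF ne] by (auto simp: group_heads_def)
  have sq: "\<forall>M \<in> set (concat ?G). square_mat M" using G(3) by auto
  have Jb: "J = diag_block_mat (concat ?G)" by (simp add: J_def real_jordan_matrix_eq)
  note crit = pair.block_hill_pick_criterion[where Bs = "concat ?G" and as = "group_heads ?G"]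
  have main: "transpose_mat (hill_pick_sub n L ?U ?U) = hill_pick_sub n L ?U ?U"
    unfolding Upsilon_eq_first_columns[OF sizes] L
    by (rule crit(1)) (fact Jb sq bicomm group_heads(1,2)[OF ne] pos inter)+
  have main': "lyapunov_dominates C J \<longleftrightarrow> psd_mat (hill_pick_sub n L ?U ?U)"
    unfolding Upsilon_eq_first_columns[OF sizes] L
    by (rule crit(2)) (fact Jb sq bicomm group_heads(1,2)[OF ne] pos inter)+
  have dom: "lyapunov_dominates B A \<longleftrightarrow> lyapunov_dominates C J"
    using lyapunov_dominates_similar[OF A J B C P(1) Q PQ(2) AP JQ BP]
      lyapunov_dominates_similar[OF J A C B Q P(1) PQ(1) JQ AP CQ] by blast

  let ?X1 = "map (Upsilon1 Cs) [0..<length Cs]" and ?X2 = "map (Upsilon2 Cs Rs) [0..<length Rs]"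
  have ms: "map length ?X1 = complex_sizes Cs"
    by (intro nth_equalityI) (auto simp: complex_sizes_def Upsilon1_def split: prod.splits)
  have ns: "map length ?X2 = real_sizes Rs"
    by (intro nth_equalityI) (auto simp: real_sizes_def Upsilon2_def split: prod.splits)
  \<comment> \<open>\<open>?X1 ! i\<close> equals \<open>Upsilon1 Cs i\<close> only for
    \<open>i\<close> in range, and likewise for \<open>?X2\<close>; \<open>block_mat\<close> reads
    no other blocks.\<close>
  have cong: "block_mat rs cs X = block_mat rs cs Y"
    if "\<And>i j. i < length rs \<Longrightarrow> j < length cs \<Longrightarrow> X i j = Y i j" for rs cs and X Y :: "nat \<Rightarrow> nat \<Rightarrow> real mat"
  proof (rule eq_matI)
    fix i j assume "i < dim_row (block_mat rs cs Y)" "j < dim_col (block_mat rs cs Y)"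
    then have ij: "i < sum_list rs" "j < sum_list cs" by (auto simp: block_mat_def)
    then show "block_mat rs cs X $$ (i, j) = block_mat rs cs Y $$ (i, j)"
      using locate_less[OF ij(1)] locate_less[OF ij(2)] that
      by (auto simp: block_mat_def split: prod.splits)
  qed (auto simp: block_mat_def)
  have lens: "length (complex_sizes Cs) = length Cs" "length (real_sizes Rs) = length Rs"
    by (auto simp: complex_sizes_def real_sizes_def)
  have U: "?U = concat ?X1 @ concat ?X2" by (simp add: Upsilon_def)
  have H: "real_hill_pick B P Cs Rs = hill_pick_sub n L ?U ?U"
    using B by (simp add: real_hill_pick_def L_def)
  have block: "real_hill_pick B P Cs Rs = four_block_mat
      (block_mat (complex_sizes Cs) (complex_sizes Cs) (\<lambda>i j. hill_pick_sub n L (Upsilon1 Cs i) (Upsilon1 Cs j)))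
      (block_mat (complex_sizes Cs) (real_sizes Rs) (\<lambda>i j. hill_pick_sub n L (Upsilon1 Cs i) (Upsilon2 Cs Rs j)))
      (transpose_mat (block_mat (complex_sizes Cs) (real_sizes Rs) (\<lambda>i j. hill_pick_sub n L (Upsilon1 Cs i) (Upsilon2 Cs Rs j))))
      (block_mat (real_sizes Rs) (real_sizes Rs) (\<lambda>i j. hill_pick_sub n L (Upsilon2 Cs Rs i) (Upsilon2 Cs Rs j)))"
  proof -
    have "block_mat (complex_sizes Cs) (complex_sizes Cs) (\<lambda>i j. hill_pick_sub n L (?X1 ! i) (?X1 ! j)) =
        block_mat (complex_sizes Cs) (complex_sizes Cs) (\<lambda>i j. hill_pick_sub n L (Upsilon1 Cs i) (Upsilon1 Cs j))"
      "block_mat (complex_sizes Cs) (real_sizes Rs) (\<lambda>i j. hill_pick_sub n L (?X1 ! i) (?X2 ! j)) =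
        block_mat (complex_sizes Cs) (real_sizes Rs) (\<lambda>i j. hill_pick_sub n L (Upsilon1 Cs i) (Upsilon2 Cs Rs j))"
      "block_mat (real_sizes Rs) (real_sizes Rs) (\<lambda>i j. hill_pick_sub n L (?X2 ! i) (?X2 ! j)) =
        block_mat (real_sizes Rs) (real_sizes Rs) (\<lambda>i j. hill_pick_sub n L (Upsilon2 Cs Rs i) (Upsilon2 Cs Rs j))"
      by (rule cong; simp add: lens)+
    then show ?thesis
      unfolding H U hill_pick_sub_append[OF main[unfolded U]] hill_pick_sub_concat ms ns by simp
  qed
  have "real_hill_pick B P Cs Rs \<in> carrier_mat (sum_list (complex_sizes Cs) + sum_list (real_sizes Rs))
      (sum_list (complex_sizes Cs) + sum_list (real_sizes Rs))"
    unfolding block by (intro four_block_carrier_mat) (auto simp: block_mat_def)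
  moreover have "complex_sizes Cs ! i = length (Upsilon1 Cs i)" if "i < length Cs" for i
    using that by (simp flip: ms)
  moreover have "real_sizes Rs ! i = length (Upsilon2 Cs Rs i)" if "i < length Rs" for i
    using that by (simp flip: ns)
  ultimately show ?thesis
    using block main' dom unfolding Let_def L_def[symmetric] H by (simp add: hill_pick_sub_def)
qed

end
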